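(* Let $n\ge 1$, $N=2^n$, and for $\boldsymbol\theta=(\theta_1,\dots,\theta_n)\in[0,2\pi)^n$ let $B(\boldsymbol\theta)=R_{\theta_n}\otimes R_{\theta_{n-1}}\otimes\cdots\otimes R_{\theta_1}\in\mathbb R^{N\times N}$ be the associated simple scalar butterfly matrix. (1) If $|\tan\theta_{j+1}|\le|\tan\theta_j|\le 1$ for each $j$, then the GENP, GEPP, GERP and GECP factorizations of $B(\boldsymbol\theta)$ all align; that is, $B(\boldsymbol\theta)$ is completely pivoted. In particular, its growth factor (with any of these strategies) is $$\rho(B(\boldsymbol\theta))=\prod_{j=1}^n \min(|\sec\theta_j|,|\csc\theta_j|)^2=\prod_{j=1}^n\bigl(1+\min(|\tan\theta_j|,|\cot\theta_j|)^2\bigr).$$ (2) Let $\boldsymbol\theta\sim\operatorname{Uniform}([0,2\pi)^n)$ and let $\sigma\in S_n$ (depending on $\boldsymbol\theta$) be such that $\tilde\theta_j=\theta_{\sigma(j)}$ satisfies $$\min(|\tan\tilde\theta_{j+1}|,|\cot\tilde\theta_{j+1}|)\le \min(|\tan\tilde\theta_j|,|\cot\tilde\theta_j|)\quad\text{for each } j.$$ Then, almost surely, the GEPP, GERP and GECP factorizations of $B(\tilde{\boldsymbol\theta})$ all align, and the growth factor $\rho(B(\tilde{\boldsymbol\theta}))$ (for any of these three strategies) has the same distribution as $\prod_{j=1}^n(1+Y_j^2)$, where $Y_1,\dots,Y_n$ are i.i.d. with the law of $|X|$ conditioned on $|X|\le1$, for $X$ a standard Cauchy random variable.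
   Context: Here $R_\theta=\begin{bmatrix}\cos\theta&\sin\theta\\-\sin\theta&\cos\theta\end{bmatrix}$ and $\otimes$ is the Kronecker product, $(A\otimes B)$ being the block matrix with blocks $A_{ij}B$. The set of all $B(\boldsymbol\theta)$ is the set of simple scalar butterfly matrices of order $N$. $S_n$ is the symmetric group on $\{1,\dots,n\}$. Conventions: $|\tan\theta|=|\sec\theta|=\infty$ if $\cos\theta=0$, and $|\cot\theta|=|\csc\theta|=\infty$ if $\sin\theta=0$. Gaussian elimination (GE), in exact arithmetic: for an invertible $A\in\mathbb R^{N\times N}$ put $A^{(1)}=A$; at step $k=1,\dots,N-1$ one (possibly) swaps rows and columns of index $\ge k$ so that a chosen nonzero pivot occupies position $(k,k)$, and then subtracts multiples of row $k$ from the rows below it to zero out column $k$ below the diagonal, producing $A^{(k+1)}$; $U=A^{(N)}$ is upper triangular. This gives a factorization $PAQ=LU$ with $P,Q$ permutation matrices, $L$ unit lower triangular and $U$ upper triangular. The pivot strategies are: - GENP (no pivoting): no swaps, $P=Q=I$. - GEPP (partial pivoting): $Q=I$; at step $k$ swap rows $k$ and $i_k$, where $i_k\ge k$ is the smallest index maximizing $|A^{(k)}_{jk}|$ over $j\ge k$. - GERP (rook pivoting): at step $k$, starting with the leading column of the untriangularized block (rows and columns of index $\ge k$), alternately search a column and then a row of the block for an entry of maximal magnitude until reaching an entry that is maximal in magnitude in both its row and its column within the block; this entry is the pivot. Ties are broken towards the current entry, then the smallest index. - GECP (complete pivoting): at step $k$ the pivot is an entry of maximal magnitude in the whole untriangularized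 block; ties are broken lexicographically in column-major order (smallest column index, then smallest row index). Factorizations for different strategies "align" if they have the same $P,Q,L,U$. A matrix is "completely pivoted" if GECP uses no row or column swaps. The growth factor is $\rho(A)=\max_k\|A^{(k)}\|_{\max}/\|A\|_{\max}$ with $\|C\|_{\max}=\max_{i,j}|C_{ij}|$, where $A^{(k)}$ are the intermediate matrices for the strategy used. *)

theory Defs
  imports
    "HOL-Probability.Probability"
    "HOL-Library.While_Combinator"
    "Jordan_Normal_Form.Column_Operations"
begin

section \<open>Simple scalar butterfly matrices\<close>

definition rot :: "real \<Rightarrow> real mat" where
  "rot \<theta> = mat_of_rows_list 2 [[cos \<theta>, sin \<theta>], [- sin \<theta>, cos \<theta>]]"

definition kron :: "real mat \<Rightarrow> real mat \<Rightarrow> real mat" where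
  "kron A B = mat (dim_row A * dim_row B) (dim_col A * dim_col B)
     (\<lambda>(i, j). A $$ (i div dim_row B, j div dim_col B) * B $$ (i mod dim_row B, j mod dim_col B))"

text \<open>\<open>butterfly n \<theta>\<close> is \<open>rot (\<theta> n) \<otimes> \<dots> \<otimes> rot (\<theta> 1)\<close>; the one-by-one identity is
  the empty product, and only the angles with index in \<open>{1..n}\<close> matter.\<close>

primrec butterfly :: "nat \<Rightarrow> (nat \<Rightarrow> real) \<Rightarrow> real mat" where
  "butterfly 0 \<theta> = 1\<^sub>m 1"
| "butterfly (Suc n) \<theta> = kron (rot (\<theta> (Suc n))) (butterfly n \<theta>)"

section \<open>Absolute values of trigonometric functions, infinite at the poles\<close>

text \<open>The library functions take the value zero at their poles (division by zero), hence the
  explicit case distinctions.\<close>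

definition abs_tan :: "real \<Rightarrow> ereal" where
  "abs_tan \<theta> = (if cos \<theta> = 0 then \<infinity> else ereal \<bar>tan \<theta>\<bar>)"

definition abs_cot :: "real \<Rightarrow> ereal" where
  "abs_cot \<theta> = (if sin \<theta> = 0 then \<infinity> else ereal \<bar>cot \<theta>\<bar>)"

definition abs_sec :: "real \<Rightarrow> ereal" where
  "abs_sec \<theta> = (if cos \<theta> = 0 then \<infinity> else ereal \<bar>1 / cos \<theta>\<bar>)"

definition abs_csc :: "real \<Rightarrow> ereal" where
  "abs_csc \<theta> = (if sin \<theta> = 0 then \<infinity> else ereal \<bar>1 / sin \<theta>\<bar>)"

section \<open>Gaussian elimination\<close>

text \<open>Rows, columns and elimination steps are numbered from 0. A pivot strategy maps the step
  \<open>k\<close> and the current matrix to the position (row, column) of the pivot, to be looked for among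
  the rows and columns of index at least \<open>k\<close>.\<close>

type_synonym pivot_strategy = "nat \<Rightarrow> real mat \<Rightarrow> nat \<times> nat"

definition eliminate :: "nat \<Rightarrow> real mat \<Rightarrow> real mat" where
  "eliminate k A = mat (dim_row A) (dim_col A)
     (\<lambda>(i, j). if k < i then A $$ (i, j) - A $$ (i, k) / A $$ (k, k) * A $$ (k, j) else A $$ (i, j))"

text \<open>\<open>ge_mat s A k\<close> is the matrix after \<open>k\<close> steps, written $A^{(k+1)}$ if one counts from 1.\<close>

primrec ge_mat :: "pivot_strategy \<Rightarrow> real mat \<Rightarrow> nat \<Rightarrow> real mat" where
  "ge_mat s A 0 = A"
| "ge_mat s A (Suc k) =
     (let C = ge_mat s A k; (r, c) = s k C in eliminate k (swaprows k r (swapcols k c C)))"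

definition ge_pivot :: "pivot_strategy \<Rightarrow> real mat \<Rightarrow> nat \<Rightarrow> nat \<times> nat" where
  "ge_pivot s A k = s k (ge_mat s A k)"

primrec ge_row_perm :: "pivot_strategy \<Rightarrow> real mat \<Rightarrow> nat \<Rightarrow> real mat" where
  "ge_row_perm s A 0 = 1\<^sub>m (dim_row A)"
| "ge_row_perm s A (Suc k) = swaprows k (fst (ge_pivot s A k)) (ge_row_perm s A k)"

primrec ge_col_perm :: "pivot_strategy \<Rightarrow> real mat \<Rightarrow> nat \<Rightarrow> real mat" where
  "ge_col_perm s A 0 = 1\<^sub>m (dim_col A)"
| "ge_col_perm s A (Suc k) = swapcols k (snd (ge_pivot s A k)) (ge_col_perm s A k)"

text \<open>The multipliers, that is, the strictly lower triangular part of \<open>L\<close>. A row swap at step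
  \<open>k\<close> also permutes the multipliers of the earlier steps. The column \<open>k\<close> added at step \<open>k\<close> is
  that of the matrix \<open>C\<close> after the swaps and before the elimination.\<close>

primrec ge_mult :: "pivot_strategy \<Rightarrow> real mat \<Rightarrow> nat \<Rightarrow> real mat" where
  "ge_mult s A 0 = 0\<^sub>m (dim_row A) (dim_row A)"
| "ge_mult s A (Suc k) =
     (let (r, c) = ge_pivot s A k;
          C = swaprows k r (swapcols k c (ge_mat s A k));
          M = swaprows k r (ge_mult s A k)
      in mat (dim_row A) (dim_row A)
           (\<lambda>(i, j). if j = k \<and> k < i then C $$ (i, k) / C $$ (k, k) else M $$ (i, j)))"

text \<open>The factors \<open>(P, Q, L, U)\<close> with \<open>P * A * Q = L * U\<close>; \<open>None\<close> if a zero pivot is met.\<close>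

definition ge_factors ::
  "pivot_strategy \<Rightarrow> real mat \<Rightarrow> (real mat \<times> real mat \<times> real mat \<times> real mat) option" where
  "ge_factors s A =
     (let m = dim_row A - 1 in
      if \<forall>k<m. ge_mat s A k $$ ge_pivot s A k \<noteq> 0
      then Some (ge_row_perm s A m, ge_col_perm s A m, 1\<^sub>m (dim_row A) + ge_mult s A m, ge_mat s A m)
      else None)"

definition factorizations_align :: "pivot_strategy set \<Rightarrow> real mat \<Rightarrow> bool" where
  "factorizations_align S A \<longleftrightarrow> (\<exists>F. \<forall>s\<in>S. ge_factors s A = Some F)"

definition max_norm :: "real mat \<Rightarrow> real" where
  "max_norm A = Max ((\<lambda>ij. \<bar>A $$ ij\<bar>) ` ({..<dim_row A} \<times> {..<dim_col A}))"

definition growth :: "pivot_strategy \<Rightarrow> real mat \<Rightarrow> real" where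
  "growth s A = Max ((\<lambda>k. max_norm (ge_mat s A k)) ` {..<dim_row A}) / max_norm A"

section \<open>Pivot strategies\<close>

definition first_max :: "nat set \<Rightarrow> (nat \<Rightarrow> real) \<Rightarrow> nat" where
  "first_max I f = (LEAST i. i \<in> I \<and> (\<forall>j\<in>I. f j \<le> f i))"

definition genp :: pivot_strategy where
  "genp k A = (k, k)"

definition gepp :: pivot_strategy where
  "gepp k A = (first_max {k..<dim_row A} (\<lambda>i. \<bar>A $$ (i, k)\<bar>), k)"

definition max_in_col :: "nat \<Rightarrow> real mat \<Rightarrow> nat \<times> nat \<Rightarrow> bool" where
  "max_in_col k A = (\<lambda>(r, c). \<forall>i\<in>{k..<dim_row A}. \<bar>A $$ (i, c)\<bar> \<le> \<bar>A $$ (r, c)\<bar>)"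

definition max_in_row :: "nat \<Rightarrow> real mat \<Rightarrow> nat \<times> nat \<Rightarrow> bool" where
  "max_in_row k A = (\<lambda>(r, c). \<forall>j\<in>{k..<dim_col A}. \<bar>A $$ (r, j)\<bar> \<le> \<bar>A $$ (r, c)\<bar>)"

text \<open>The search starts in column \<open>k\<close> at the entry \<open>(k, k)\<close>. After a move within a column the
  current entry is maximal in it, so that the next move, if any, is within its row, and vice
  versa: columns and rows are searched alternately. The current entry is kept if it is among the
  maximal ones. Every move strictly increases the magnitude, so the loop terminates.\<close>

definition gerp :: pivot_strategy where
  "gerp k A =
     while (\<lambda>p. \<not> (max_in_col k A p \<and> max_in_row k A p))
       (\<lambda>(r, c). if max_in_col k A (r, c)
                 then (r, first_max {k..<dim_col A} (\<lambda>j. \<bar>A $$ (r, j)\<bar>))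
                 else (first_max {k..<dim_row A} (\<lambda>i. \<bar>A $$ (i, c)\<bar>), c))
       (k, k)"

definition block_maxima :: "nat \<Rightarrow> real mat \<Rightarrow> (nat \<times> nat) set" where
  "block_maxima k A =
     (let I = {k..<dim_row A} \<times> {k..<dim_col A} in {p \<in> I. \<forall>q\<in>I. \<bar>A $$ q\<bar> \<le> \<bar>A $$ p\<bar>})"

definition gecp :: pivot_strategy where
  "gecp k A =
     (let c = (LEAST c. \<exists>r. (r, c) \<in> block_maxima k A);
          r = (LEAST r. (r, c) \<in> block_maxima k A)
      in (r, c))"

definition completely_pivoted :: "real mat \<Rightarrow> bool" where
  "completely_pivoted A \<longleftrightarrow> (\<forall>k < dim_row A - 1. ge_pivot gecp A k = (k, k))"

section \<open>Probability distributions\<close>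

definition std_cauchy :: "real measure" where
  "std_cauchy = density lborel (\<lambda>x. ennreal (1 / (pi * (1 + x\<^sup>2))))"

text \<open>The law of \<open>\<bar>X\<bar>\<close> conditioned on \<open>\<bar>X\<bar> \<le> 1\<close> for a standard Cauchy variable \<open>X\<close>;
  \<^const>\<open>uniform_measure\<close> applied to a probability measure and an event is the conditional
  probability given that event.\<close>

definition cond_abs_cauchy :: "real measure" where
  "cond_abs_cauchy = distr (uniform_measure std_cauchy {x. \<bar>x\<bar> \<le> 1}) borel (\<lambda>x. \<bar>x\<bar>)"

definition uniform_angles :: "nat \<Rightarrow> (nat \<Rightarrow> real) measure" where
  "uniform_angles n =
     uniform_measure (\<Pi>\<^sub>M j\<in>{1..n}. lborel) (\<Pi>\<^sub>E j\<in>{1..n}. {0..<2 * pi})"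

end

theory Submission
  imports Defs
begin

text \<open>
Up to the order of its rows and a factor for each row, a rotation matrix is
$\begin{pmatrix}1 & t\cr -t & 1\end{pmatrix}$, where $|t|\le 1$ is the smaller one of $|\tan\theta|$ and
$|\cot\theta|$; rows are exchanged only if $|\tan\theta|>1$. Kronecker products inherit this
(\<open>butterfly_row_perm\<close>): a butterfly matrix is a row permutation of the Kronecker product of these
matrices, with rows multiplied by factors of the same magnitude.

For the latter product, elimination without pivoting can be followed explicitly: its Schur
complements have a recursive block form (\<open>schur\<close>, \<open>schur_step\<close>). The pivots are products of
numbers $1+t_j^2$, one for each binary digit $1$ of the step number, so the first one is $1$
and the last one is $\prod_j(1+t_j^2)$, the largest of all. The heart of the matter is that each pivot
is maximal in its whole Schur complement if $|t_1|\ge|t_2|\ge\dots$, the outermost factor having the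
smallest parameter (\<open>schur_bound\<close>); this is proved by induction for a whole family of affine
combinations of the matrix and its Schur complement, since the block recursion produces such
combinations.

If all pivots are maximal in this sense, then every strategy finds them, whatever the row
permutation, as long as the maximum in the pivot column is unique or the rows are in order
(\<open>ge_mat_gepp\<close>): no column is ever moved, and each step puts one row into its place. Uniqueness
holds if all $|t_j|<1$ (\<open>schur_col_strict\<close>). Hence the factorizations align, and the growth factor is
the quotient of the last and the first pivot, $\prod_j(1+t_j^2)$.

For random angles, $|t_j|<1$ almost surely, and $|t_j|$ has the distribution function
$\frac{4}{\pi}\arctan x$ on $[0,1]$, which is also that of a standard Cauchy variable in
magnitude, conditioned on being at most one (\<open>distr_abs_skew\<close>). The growth factor is a symmetric
function of the $t_j$, so the sorting does not influence its law.
\<close>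

section \<open>Schur complements of Kronecker products\<close>

fun rot_entry :: "real \<Rightarrow> bool \<Rightarrow> bool \<Rightarrow> real" where
  "rot_entry t a b = (if a = b then 1 else if a then - t else t)"

text \<open>The Kronecker product of the matrices $\begin{pmatrix}1 & t_j\cr -t_j & 1\end{pmatrix}$, the factor
with the largest index being the outermost, so that its row is the leading binary digit of the
row index. If \<open>t j\<close> is the tangent of the \<open>j\<close>-th angle, then it is the butterfly matrix divided by
the product of the cosines.\<close>

primrec normalized_kron :: "nat \<Rightarrow> (nat \<Rightarrow> real) \<Rightarrow> nat \<Rightarrow> nat \<Rightarrow> real" where
  "normalized_kron 0 t i j = 1"
| "normalized_kron (Suc n) t i j =
     rot_entry (t (Suc n)) (2 ^ n \<le> i) (2 ^ n \<le> j) * normalized_kron n t (i mod 2 ^ n) (j mod 2 ^ n)"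

text \<open>The Schur complement left after \<open>k\<close> elimination steps without pivoting, as a matrix of full
size with zeros in the first \<open>k\<close> rows and columns. Write \<open>X\<close> for the Kronecker product of the
inner \<open>n\<close> factors, \<open>Y\<close> for its Schur complement, and \<open>\<tau>\<close> for the parameter of the
outermost factor. While the leading block \<open>X\<close> is being eliminated, the blocks are \<open>Y\<close>,
\<open>\<tau> Y\<close>, \<open>- \<tau> Y\<close> and, since the eliminated part of \<open>X\<close> is \<open>X - Y\<close>,
\<open>X + \<tau>\<^sup>2 (X - Y)\<close>. After \<open>2 ^ n\<close> steps only \<open>(1 + \<tau>\<^sup>2) X\<close> is left, and the same
process starts again there. The padding with zeros makes this block description and
the elimination step hold for all indices.\<close>

primrec schur :: "nat \<Rightarrow> (nat \<Rightarrow> real) \<Rightarrow> nat \<Rightarrow> nat \<Rightarrow> nat \<Rightarrow> real" where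
  "schur 0 t k i j = (if k = 0 then 1 else 0)"
| "schur (Suc n) t k i j =
     (let \<tau> = t (Suc n); i' = i mod 2 ^ n; j' = j mod 2 ^ n in
      if k < 2 ^ n then
        (if 2 ^ n \<le> i \<and> 2 ^ n \<le> j
         then (1 + \<tau>\<^sup>2) * normalized_kron n t i' j' - \<tau>\<^sup>2 * schur n t k i' j'
         else rot_entry \<tau> (2 ^ n \<le> i) (2 ^ n \<le> j) * schur n t k i' j')
      else
        (if 2 ^ n \<le> i \<and> 2 ^ n \<le> j then (1 + \<tau>\<^sup>2) * schur n t (k - 2 ^ n) i' j' else 0))"

lemma schur_0: "schur n t 0 i j = normalized_kron n t i j"
  by (induction n arbitrary: i j) (auto simp: Let_def algebra_simps)

lemma schur_full: "schur n t (2 ^ n) i j = 0"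
  by (induction n arbitrary: i j) (auto simp: Let_def)

lemma mod_pow2_upper:
  assumes "2 ^ n \<le> (k::nat)" "k < 2 ^ Suc n"
  shows "k mod 2 ^ n = k - 2 ^ n"
  using assms by (simp add: le_mod_geq)

lemma pivot_ge_1: "k < 2 ^ n \<Longrightarrow> 1 \<le> schur n t k k k"
proof (induction n arbitrary: k)
  case (Suc n)
  show ?case
  proof (cases "k < 2 ^ n")
    case False
    then have "1 \<le> schur n t (k - 2 ^ n) (k - 2 ^ n) (k - 2 ^ n)"
      using Suc by simp
    then have "1 * 1 \<le> (1 + (t (Suc n))\<^sup>2) * schur n t (k - 2 ^ n) (k - 2 ^ n) (k - 2 ^ n)"
      by (intro mult_mono) auto
    then show ?thesis
      using False Suc.prems by (simp add: Let_def mod_pow2_upper)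
  qed (use Suc in \<open>simp add: Let_def\<close>)
qed simp

lemma pivot_le: "k < 2 ^ n \<Longrightarrow> schur n t k k k \<le> (\<Prod>j\<in>{1..n}. 1 + (t j)\<^sup>2)"
proof (induction n arbitrary: k)
  case (Suc n)
  let ?P = "\<Prod>j\<in>{1..n}. 1 + (t j)\<^sup>2"
  have P: "0 \<le> ?P" by (intro prod_nonneg) auto
  have e: "(\<Prod>j\<in>{1..Suc n}. 1 + (t j)\<^sup>2) = (1 + (t (Suc n))\<^sup>2) * ?P"
    by simp
  show ?case
  proof (cases "k < 2 ^ n")
    case True
    then have "schur n t k k k \<le> 1 * ?P"
      using Suc by simp
    also have "\<dots> \<le> (1 + (t (Suc n))\<^sup>2) * ?P"
      using P by (intro mult_right_mono) auto
    finally show ?thesis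
      unfolding e using True by (simp add: Let_def)
  next
    case False
    then have "(1 + (t (Suc n))\<^sup>2) * schur n t (k - 2 ^ n) (k - 2 ^ n) (k - 2 ^ n)
        \<le> (1 + (t (Suc n))\<^sup>2) * ?P"
      using Suc by (intro mult_left_mono) auto
    then show ?thesis
      unfolding e using False Suc.prems by (simp add: Let_def mod_pow2_upper)
  qed
qed simp

lemma last_pivot: "schur n t (2 ^ n - 1) (2 ^ n - 1) (2 ^ n - 1) = (\<Prod>j\<in>{1..n}. 1 + (t j)\<^sup>2)"
proof (induction n)
  case (Suc n)
  have *: "(2::nat) ^ n \<le> 2 ^ Suc n - 1" "(2::nat) ^ Suc n - 1 < 2 ^ Suc n"
    "(2::nat) ^ Suc n - 1 - 2 ^ n = 2 ^ n - 1"
    by auto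
  have "schur (Suc n) t (2 ^ Suc n - 1) (2 ^ Suc n - 1) (2 ^ Suc n - 1)
      = (1 + (t (Suc n))\<^sup>2) * schur n t (2 ^ n - 1) (2 ^ n - 1) (2 ^ n - 1)"
    using * mod_pow2_upper[OF *(1,2)] by (simp add: Let_def del: power_Suc)
  then show ?case using Suc by simp
qed simp

text \<open>The link between the block recursion and elimination. In the last block, the rank-one update of
\<open>Y\<close> is multiplied by \<open>- \<tau>\<^sup>2\<close>, which is also what the off-diagonal factors \<open>- \<tau>\<close> and \<open>\<tau>\<close> of the
pivot column and the pivot row produce.\<close>

lemma schur_step:
  "k < 2 ^ n \<Longrightarrow> i < 2 ^ n \<Longrightarrow> j < 2 ^ n \<Longrightarrow>
    schur n t (Suc k) i j = schur n t k i j - schur n t k i k / schur n t k k k * schur n t k k j"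
proof (induction n arbitrary: k i j)
  case (Suc n)
  define i' j' \<tau> where "i' = i mod 2 ^ n" and "j' = j mod 2 ^ n" and "\<tau> = t (Suc n)"
  have lt: "i' < 2 ^ n" "j' < 2 ^ n" by (simp_all add: i'_def j'_def)
  show ?case
  proof (cases "k < 2 ^ n")
    case True
    have IH: "schur n t (Suc k) i' j'
        = schur n t k i' j' - schur n t k i' k / schur n t k k k * schur n t k k j'"
      using Suc.IH[OF True lt] .
    \<comment> \<open>The last step inside the leading block is described by the second case of the recursion;
both cases agree there because the inner Schur complement has become zero.\<close>
    have full: "schur n t (Suc k) i' j' = 0" if "\<not> Suc k < 2 ^ n"
    proof -
      have "Suc k = 2 ^ n" using that True by simp
      then show ?thesis using schur_full by metis
    qed
    have nxt: "schur (Suc n) t (Suc k) i j =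
       (if 2 ^ n \<le> i \<and> 2 ^ n \<le> j then (1 + \<tau>\<^sup>2) * normalized_kron n t i' j' - \<tau>\<^sup>2 * schur n t (Suc k) i' j'
         else rot_entry \<tau> (2 ^ n \<le> i) (2 ^ n \<le> j) * schur n t (Suc k) i' j')"
    proof (cases "Suc k < 2 ^ n")
      case False
      then have "Suc k - 2 ^ n = 0" using True by simp
      with False full show ?thesis
        by (simp only: schur.simps Let_def i'_def j'_def \<tau>_def) (simp add: schur_0)
    qed (simp add: Let_def i'_def j'_def \<tau>_def)
    show ?thesis
      unfolding nxt IH using True
      by (auto simp add: Let_def i'_def[symmetric] j'_def[symmetric] \<tau>_def[symmetric]
           algebra_simps power2_eq_square)
  next
    case False
    define k' where "k' = k - 2 ^ n"
    have k': "k' < 2 ^ n" "Suc k - 2 ^ n = Suc k'" "k mod 2 ^ n = k'"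
      using False Suc.prems by (auto simp: k'_def mod_pow2_upper)
    define s where "s = 1 + \<tau>\<^sup>2"
    have s: "s \<noteq> 0"
      unfolding s_def by (metis add_pos_nonneg less_numeral_extra(1,3) zero_le_power2)
    show ?thesis
    proof (cases "2 ^ n \<le> i \<and> 2 ^ n \<le> j")
      case True
      have "s * schur n t (Suc k') i' j'
          = s * schur n t k' i' j' - (s * schur n t k' i' k') / (s * schur n t k' k' k') * (s * schur n t k' k' j')"
        using Suc.IH[OF k'(1) lt] s by (simp add: right_diff_distrib)
      then show ?thesis
        using True False k' by (simp add: Let_def flip: i'_def j'_def \<tau>_def s_def k'_def)
    qed (use False in \<open>auto simp add: Let_def\<close>)
  qed
qed simp

text \<open>The expression is affine in \<open>\<alpha>\<close>, so it suffices to bound it at the two ends of the interval.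
At \<open>\<alpha> = 0\<close> it is \<open>(1 + \<tau>) * y\<close>. At \<open>\<alpha> = 1 + \<tau>\<close> it is \<open>(1 + \<tau>) * (x - \<tau> * y)\<close>, where
\<open>(1 + \<tau>) * (x - \<tau> * y) = ((1 + \<tau>) * x - \<tau> * y) - \<tau>\<^sup>2 * y\<close> is at most
\<open>(1 + \<tau>\<^sup>2) * D \<le> (1 + \<tau>) * D\<close> in magnitude. It is used for entries of the inner product matrix and of its
Schur complement, with the square of the outermost parameter for \<open>\<tau>\<close>.\<close>

lemma convex_step:
  fixes x y D :: real
  assumes "\<bar>x\<bar> \<le> D" "\<bar>y\<bar> \<le> D" "0 \<le> \<tau>" "\<tau> \<le> 1"
    and "\<bar>(1 + \<tau>) * x - \<tau> * y\<bar> \<le> D" and "0 \<le> \<alpha>" "\<alpha> \<le> 1 + \<tau>"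
  shows "\<bar>\<alpha> * x + (1 - \<alpha>) * ((1 + \<tau>) * y)\<bar> \<le> (1 + \<tau>) * D"
proof -
  define l where "l = \<alpha> / (1 + \<tau>)"
  have l: "\<alpha> = l * (1 + \<tau>)" "0 \<le> l" "l \<le> 1"
    using assms by (auto simp: l_def field_simps)
  have D: "0 \<le> D" using assms(1) by linarith
  have "\<bar>(1 + \<tau>) * (x - \<tau> * y)\<bar> = \<bar>((1 + \<tau>) * x - \<tau> * y) - \<tau>\<^sup>2 * y\<bar>"
    by (simp add: algebra_simps power2_eq_square)
  also have "\<dots> \<le> D + \<tau>\<^sup>2 * D"
    using mult_left_mono[OF assms(2) zero_le_power2[of \<tau>]] assms(5)
      abs_triangle_ineq4[of "(1 + \<tau>) * x - \<tau> * y" "\<tau>\<^sup>2 * y"]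
    unfolding abs_mult[of "\<tau>\<^sup>2"] abs_power2 by linarith
  also have "\<dots> \<le> D + \<tau> * D"
    using assms D by (intro add_left_mono mult_right_mono) (auto simp: power2_eq_square mult_left_le)
  also have "\<dots> = (1 + \<tau>) * D"
    by (simp add: algebra_simps)
  finally have "(1 + \<tau>) * \<bar>x - \<tau> * y\<bar> \<le> (1 + \<tau>) * D"
    using assms by (simp add: abs_mult)
  then have e: "\<bar>x - \<tau> * y\<bar> \<le> D"
    using assms by simp
  have "\<bar>(1 - l) * y + l * (x - \<tau> * y)\<bar> \<le> (1 - l) * D + l * D"
    using l e assms(2)
    by (intro order_trans[OF abs_triangle_ineq] add_mono) (auto simp: abs_mult intro: mult_left_mono)
  then have "(1 + \<tau>) * \<bar>(1 - l) * y + l * (x - \<tau> * y)\<bar> \<le> (1 + \<tau>) * D"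
    using assms by (intro mult_left_mono) (auto simp: algebra_simps)
  moreover have "\<alpha> * x + (1 - \<alpha>) * ((1 + \<tau>) * y) = (1 + \<tau>) * ((1 - l) * y + l * (x - \<tau> * y))"
    unfolding l(1) by (simp add: algebra_simps)
  ultimately show ?thesis
    using assms by (simp add: abs_mult)
qed

text \<open>At \<open>\<alpha> = 0\<close> this says that the diagonal entry is maximal in the whole Schur complement, which is
what complete pivoting asks for. That special case alone is not inductive: the last block
of the recursion is the affine combination \<open>(1 + \<tau>\<^sup>2) X - \<tau>\<^sup>2 Y\<close> with weights of opposite signs.
Admitting all weights \<open>\<alpha>\<close> up to the smallest \<open>1 + (t m)\<^sup>2\<close> closes the induction, because a
combination with weight \<open>\<alpha>\<close> in that block is a combination of \<open>X\<close> and \<open>Y\<close> with weight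
\<open>1 + (1 - \<alpha>) \<tau>\<^sup>2\<close>, which lies between \<open>0\<close> and \<open>1 + \<tau>\<^sup>2\<close>. This is where the
ordering enters: the outermost parameter must be the smallest one, so that this weight is again
admissible for the inner factors.\<close>

lemma schur_bound:
  assumes "\<And>i j. 1 \<le> i \<Longrightarrow> i \<le> j \<Longrightarrow> j \<le> n \<Longrightarrow> \<bar>t j\<bar> \<le> \<bar>t i\<bar>"
    and "\<And>j. 1 \<le> j \<Longrightarrow> j \<le> n \<Longrightarrow> \<bar>t j\<bar> \<le> 1"
    and "k < 2 ^ n" "i < 2 ^ n" "j < 2 ^ n"
    and "0 \<le> \<alpha>" "\<And>m. 1 \<le> m \<Longrightarrow> m \<le> n \<Longrightarrow> \<alpha> \<le> 1 + (t m)\<^sup>2"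
  shows "\<bar>\<alpha> * normalized_kron n t i j + (1 - \<alpha>) * schur n t k i j\<bar> \<le> schur n t k k k"
  using assms
proof (induction n arbitrary: k i j \<alpha>)
  case (Suc n)
  define i' j' \<tau> x where "i' = i mod 2 ^ n" and "j' = j mod 2 ^ n" and "\<tau> = t (Suc n)"
    and "x = normalized_kron n t i' j'"
  have lt: "i' < 2 ^ n" "j' < 2 ^ n" by (simp_all add: i'_def j'_def)
  have \<tau>1: "\<bar>\<tau>\<bar> \<le> 1" using Suc.prems(2)[of "Suc n"] by (simp add: \<tau>_def)
  then have \<tau>2: "\<tau>\<^sup>2 \<le> 1" by (simp add: abs_square_le_1)
  have \<tau>m: "\<tau>\<^sup>2 \<le> (t m)\<^sup>2" if "1 \<le> m" "m \<le> n" for m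
    using Suc.prems(1)[of m "Suc n"] that by (simp add: \<tau>_def abs_le_square_iff)
  have \<alpha>: "\<alpha> \<le> 1 + \<tau>\<^sup>2" using Suc.prems(7)[of "Suc n"] by (simp add: \<tau>_def)
  have IH: "\<bar>\<beta> * x + (1 - \<beta>) * schur n t k' i' j'\<bar> \<le> schur n t k' k' k'"
    if "k' < 2 ^ n" "0 \<le> \<beta>" "\<beta> \<le> 1 + \<tau>\<^sup>2" for k' \<beta>
    unfolding x_def
    by (rule Suc.IH) (use Suc.prems(1,2) that lt \<tau>m in \<open>auto intro: order_trans[OF that(3)]\<close>)
  have rot: "\<bar>rot_entry \<tau> a b\<bar> \<le> 1" for a b
    using \<tau>1 by auto
  show ?case
  proof (cases "k < 2 ^ n")
    case True
    define y where "y = schur n t k i' j'"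
    have kk: "schur (Suc n) t k k k = schur n t k k k"
      using True by (simp add: Let_def)
    show ?thesis
    proof (cases "2 ^ n \<le> i \<and> 2 ^ n \<le> j")
      case both: True
      define \<beta> where "\<beta> = \<alpha> + (1 - \<alpha>) * (1 + \<tau>\<^sup>2)"
      have "(1 - \<alpha>) * \<tau>\<^sup>2 \<le> 1 * \<tau>\<^sup>2"
        using Suc.prems(6) by (intro mult_right_mono) auto
      moreover have "(1 - \<alpha>) * \<tau>\<^sup>2 \<ge> (- 1) * \<tau>\<^sup>2"
        using \<alpha> \<tau>2 by (intro mult_right_mono) auto
      ultimately have \<beta>: "0 \<le> \<beta>" "\<beta> \<le> 1 + \<tau>\<^sup>2"
        using \<tau>2 by (auto simp: \<beta>_def algebra_simps)
      have "\<alpha> * x + (1 - \<alpha>) * ((1 + \<tau>\<^sup>2) * x - \<tau>\<^sup>2 * y) = \<beta> * x + (1 - \<beta>) * y"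
        by (simp add: \<beta>_def algebra_simps)
      with IH[OF True \<beta>] show ?thesis
        using True both unfolding kk
        by (simp add: Let_def y_def flip: i'_def j'_def \<tau>_def x_def)
    next
      case False
      have "\<bar>rot_entry \<tau> (2 ^ n \<le> i) (2 ^ n \<le> j) * (\<alpha> * x + (1 - \<alpha>) * y)\<bar> \<le> 1 * schur n t k k k"
        unfolding abs_mult y_def using rot IH[OF True Suc.prems(6) \<alpha>] by (intro mult_mono) auto
      moreover have "\<alpha> * normalized_kron (Suc n) t i j + (1 - \<alpha>) * schur (Suc n) t k i j
          = rot_entry \<tau> (2 ^ n \<le> i) (2 ^ n \<le> j) * (\<alpha> * x + (1 - \<alpha>) * y)"
        using True False
        by (auto simp add: Let_def y_def algebra_simps simp flip: i'_def j'_def \<tau>_def x_def)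
      ultimately show ?thesis
        unfolding kk by simp
    qed
  next
    case False
    define k' where "k' = k - 2 ^ n"
    have k': "k' < 2 ^ n" "k mod 2 ^ n = k'"
      using False Suc.prems by (auto simp: k'_def mod_pow2_upper)
    have kk: "schur (Suc n) t k k k = (1 + \<tau>\<^sup>2) * schur n t k' k' k'"
      using False k' by (simp add: Let_def flip: \<tau>_def k'_def)
    note bounds = IH[OF k'(1), of 1] IH[OF k'(1), of 0] IH[OF k'(1), of "1 + \<tau>\<^sup>2"]
    show ?thesis
    proof (cases "2 ^ n \<le> i \<and> 2 ^ n \<le> j")
      case True
      have "\<bar>\<alpha> * x + (1 - \<alpha>) * ((1 + \<tau>\<^sup>2) * schur n t k' i' j')\<bar> \<le> (1 + \<tau>\<^sup>2) * schur n t k' k' k'"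
        using bounds \<tau>2 \<alpha> Suc.prems(6) by (intro convex_step) auto
      then show ?thesis
        unfolding kk using True False
        by (simp add: Let_def flip: i'_def j'_def \<tau>_def x_def k'_def)
    next
      case F: False
      have "\<bar>rot_entry \<tau> (2 ^ n \<le> i) (2 ^ n \<le> j) * x\<bar> \<le> 1 * schur n t k' k' k'"
        unfolding abs_mult using rot bounds(1) by (intro mult_mono) auto
      then have "\<bar>\<alpha>\<bar> * \<bar>rot_entry \<tau> (2 ^ n \<le> i) (2 ^ n \<le> j) * x\<bar> \<le> (1 + \<tau>\<^sup>2) * schur n t k' k' k'"
        using \<alpha> Suc.prems(6) by (intro mult_mono) auto
      then show ?thesis
        unfolding kk using F False
        by (auto simp add: Let_def abs_mult simp flip: i'_def j'_def \<tau>_def x_def k'_def)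
    qed
  qed
qed simp

text \<open>Ties in a pivot column can only come from parameters of magnitude one: the entries of the
column relative to its diagonal entry are products of parameters up to sign, or zero.\<close>

lemma schur_col_strict:
  assumes "\<And>j. 1 \<le> j \<Longrightarrow> j \<le> n \<Longrightarrow> \<bar>t j\<bar> < 1"
    and "k < 2 ^ n" "i < 2 ^ n" "i \<noteq> k"
  shows "\<bar>schur n t k i k\<bar> < schur n t k k k"
  using assms
proof (induction n arbitrary: k i)
  case (Suc n)
  define i' \<tau> where "i' = i mod 2 ^ n" and "\<tau> = t (Suc n)"
  have lt: "i' < 2 ^ n" by (simp add: i'_def)
  have \<tau>1: "\<bar>\<tau>\<bar> < 1" using Suc.prems(1)[of "Suc n"] by (simp add: \<tau>_def)
  have IH: "\<bar>schur n t k' l k'\<bar> < schur n t k' k' k'" if "k' < 2 ^ n" "l < 2 ^ n" "l \<noteq> k'" for k' l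
    by (rule Suc.IH) (use Suc.prems(1) that in auto)
  show ?case
  proof (cases "k < 2 ^ n")
    case True
    have pos: "0 < schur n t k k k"
      using pivot_ge_1[OF True, of t] by linarith
    show ?thesis
    proof (cases "2 ^ n \<le> i")
      case upper: True
      have "\<bar>schur n t k i' k\<bar> \<le> schur n t k k k"
        using IH[OF True lt] pos by (cases "i' = k") auto
      then have "\<bar>\<tau>\<bar> * \<bar>schur n t k i' k\<bar> \<le> \<bar>\<tau>\<bar> * schur n t k k k"
        by (intro mult_left_mono) auto
      also have "\<dots> < 1 * schur n t k k k"
        using \<tau>1 pos by (intro mult_strict_right_mono)
      finally show ?thesis
        using True upper by (simp add: Let_def abs_mult flip: i'_def \<tau>_def)
    next
      case False
      then show ?thesis
        using IH[OF True, of i] True Suc.prems by (simp add: Let_def)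
    qed
  next
    case False
    define k' where "k' = k - 2 ^ n"
    have k': "k' < 2 ^ n" "k mod 2 ^ n = k'"
      using False Suc.prems by (auto simp: k'_def mod_pow2_upper)
    have pos: "0 < 1 + \<tau>\<^sup>2" by (simp add: add_pos_nonneg)
    have "i' \<noteq> k'" if "2 ^ n \<le> i"
      using that False Suc.prems k'_def by (simp add: i'_def mod_pow2_upper)
    then show ?thesis
      using IH[OF k'(1) lt] pos pivot_ge_1[OF k'(1), of t] k' False
      by (simp add: Let_def abs_mult flip: i'_def \<tau>_def k'_def)
  qed
qed simp

section \<open>Pivot searches and dominant pivots\<close>

lemma first_max_eq:
  assumes "r \<in> I" "\<And>j. j \<in> I \<Longrightarrow> f j \<le> f r" "\<And>j. j \<in> I \<Longrightarrow> j < r \<Longrightarrow> f j < f r"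
  shows "first_max I f = r"
  unfolding first_max_def
proof (rule Least_equality)
  fix i assume "i \<in> I \<and> (\<forall>j\<in>I. f j \<le> f i)"
  then show "r \<le> i"
    using assms by (metis not_le)
qed (use assms in auto)

text \<open>The condition under which all three searches end at row \<open>r\<close> of the leading column: that entry is
maximal in the whole remaining block, and it is the first such entry in its column. Ties in other
columns are harmless, since complete pivoting prefers the smallest column index and rook pivoting
stays at an entry that is maximal in its row and its column.\<close>

definition lead_max :: "nat \<Rightarrow> real mat \<Rightarrow> nat \<Rightarrow> bool" where
  "lead_max k A r \<longleftrightarrow> k \<le> r \<and> r < dim_row A \<and> k < dim_col A \<and>
     (\<forall>i\<in>{k..<dim_row A}. \<forall>j\<in>{k..<dim_col A}. \<bar>A $$ (i, j)\<bar> \<le> \<bar>A $$ (r, k)\<bar>) \<and>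
     (\<forall>i\<in>{k..<r}. \<bar>A $$ (i, k)\<bar> < \<bar>A $$ (r, k)\<bar>)"

lemma gepp_lead_max: "lead_max k A r \<Longrightarrow> gepp k A = (r, k)"
  unfolding gepp_def lead_max_def by (auto intro!: first_max_eq)

lemma gecp_lead_max:
  assumes "lead_max k A r"
  shows "gecp k A = (r, k)"
proof -
  have r: "(r, k) \<in> block_maxima k A"
    using assms by (auto simp: block_maxima_def lead_max_def)
  have c: "(LEAST c. \<exists>r. (r, c) \<in> block_maxima k A) = k"
    by (rule Least_equality) (use r in \<open>auto simp: block_maxima_def\<close>)
  have "(LEAST i. (i, k) \<in> block_maxima k A) = r"
  proof (rule Least_equality, rule r)
    fix i assume i: "(i, k) \<in> block_maxima k A"
    then have "k \<le> i" "\<bar>A $$ (r, k)\<bar> \<le> \<bar>A $$ (i, k)\<bar>"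
      using r by (auto simp: block_maxima_def)
    then have "\<not> (k \<le> i \<and> i < r)"
      using assms unfolding lead_max_def by (metis atLeastLessThan_iff not_le)
    then show "r \<le> i"
      using \<open>k \<le> i\<close> by simp
  qed
  then show ?thesis
    by (simp add: gecp_def c)
qed

lemma gerp_lead_max:
  assumes "lead_max k A r"
  shows "gerp k A = (r, k)"
proof -
  have stop: "max_in_col k A (r, k)" "max_in_row k A (r, k)"
    using assms by (auto simp: max_in_col_def max_in_row_def lead_max_def)
  show ?thesis
  proof (cases "r = k")
    case True
    then show ?thesis
      using stop unfolding gerp_def by (subst while_unfold) simp
  next
    case False
    then have "\<bar>A $$ (k, k)\<bar> < \<bar>A $$ (r, k)\<bar>" "r \<in> {k..<dim_row A}"
      using assms by (auto simp: lead_max_def)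
    then have "\<not> max_in_col k A (k, k)"
      unfolding max_in_col_def prod.case by (meson not_le)
    moreover have "first_max {k..<dim_row A} (\<lambda>i. \<bar>A $$ (i, k)\<bar>) = r"
      using gepp_lead_max[OF assms] by (simp add: gepp_def)
    ultimately show ?thesis
      using stop unfolding gerp_def by (subst while_unfold, subst while_unfold) simp
  qed
qed

lemma ge_mat_dim [simp]:
  "dim_row (ge_mat s A k) = dim_row A" "dim_col (ge_mat s A k) = dim_col A"
  by (induction k) (auto simp: eliminate_def Let_def split: prod.splits)

text \<open>Two strategies that choose the same pivots along the elimination steered by one of them produce
the same matrices and factors. It therefore suffices to follow partial pivoting.\<close>

lemma ge_same_pivots:
  assumes "\<And>k. k < m \<Longrightarrow> ge_pivot s A k = s' k (ge_mat s A k)" and "k \<le> m"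
  shows "ge_mat s' A k = ge_mat s A k" "ge_row_perm s' A k = ge_row_perm s A k"
    "ge_col_perm s' A k = ge_col_perm s A k" "ge_mult s' A k = ge_mult s A k"
proof -
  have mat: "ge_mat s' A k = ge_mat s A k" if "k \<le> m" for k
    using that
  proof (induction k)
    case (Suc k)
    then show ?case using assms(1)[of k] by (simp add: Let_def ge_pivot_def)
  qed simp
  have piv: "ge_pivot s' A k = ge_pivot s A k" if "k < m" for k
    using that mat[of k] assms(1)[of k] by (simp add: ge_pivot_def)
  show "ge_mat s' A k = ge_mat s A k" using mat assms(2) .
  show "ge_row_perm s' A k = ge_row_perm s A k" "ge_col_perm s' A k = ge_col_perm s A k"
    using assms(2) by (induction k) (auto simp: piv)
  show "ge_mult s' A k = ge_mult s A k"
    using assms(2) by (induction k) (auto simp: piv mat)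
qed

text \<open>An elimination process \<open>G\<close> without pivoting, where \<open>G k\<close> is the \<open>k\<close>-th Schur complement padded
with zeros, whose diagonal pivots dominate. The matrix to be eliminated is the one whose
row \<open>i\<close> is row \<open>\<pi> i\<close> of \<open>G 0\<close>. If the rows really are permuted, then the maxima in the pivot
columns must be strict, for otherwise a tie could make a strategy pick the wrong row; without a
permutation the diagonal entry comes first and wins all ties.\<close>

definition tame_elimination ::
  "nat \<Rightarrow> (nat \<Rightarrow> nat) \<Rightarrow> (nat \<Rightarrow> nat \<Rightarrow> nat \<Rightarrow> real) \<Rightarrow> bool" where
  "tame_elimination N \<pi> G \<longleftrightarrow>
     (\<forall>k<N. G k k k \<noteq> 0) \<and>
     (\<forall>k<N. \<forall>i<N. \<forall>j<N. \<bar>G k i j\<bar> \<le> \<bar>G k k k\<bar>) \<and>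
     (\<forall>k<N. \<forall>i<N. \<forall>j<N. G (Suc k) i j = G k i j - G k i k / G k k k * G k k j) \<and>
     \<pi> permutes {..<N} \<and>
     (\<pi> = id \<or> (\<forall>k<N. \<forall>i<N. i \<noteq> k \<longrightarrow> \<bar>G k i k\<bar> < \<bar>G k k k\<bar>))"

text \<open>Partial pivoting undoes the row permutation step by step. After \<open>k\<close> steps the rows are permuted by
some \<open>p\<close> that fixes all indices below \<open>k\<close>. A row of index \<open>i < k\<close> is finished and was last changed in
step \<open>i\<close>, whence the index \<open>min i k\<close>. The next pivot is in the row that \<open>p\<close> maps to \<open>k\<close>. The lemma
also states that this entry passes as a pivot for all strategies.\<close>

lemma ge_mat_gepp:
  assumes tame: "tame_elimination N \<pi> G"
    and dim: "dim_row A = N" "dim_col A = N"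
    and A: "\<And>i j. i < N \<Longrightarrow> j < N \<Longrightarrow> A $$ (i, j) = G 0 (\<pi> i) j"
    and "k \<le> N"
  shows "\<exists>p. p permutes {..<N} \<and> (\<forall>i<k. p i = i) \<and> (\<pi> = id \<longrightarrow> p = id) \<and>
    (\<forall>i<N. \<forall>j<N. ge_mat gepp A k $$ (i, j) = G (min i k) (p i) j) \<and>
    (k < N \<longrightarrow> lead_max k (ge_mat gepp A k) (inv_into UNIV p k))"
proof -
  have nz: "\<And>k. k < N \<Longrightarrow> G k k k \<noteq> 0"
    and bd: "\<And>k i j. k < N \<Longrightarrow> i < N \<Longrightarrow> j < N \<Longrightarrow> \<bar>G k i j\<bar> \<le> \<bar>G k k k\<bar>"
    and step: "\<And>k i j. k < N \<Longrightarrow> i < N \<Longrightarrow> j < N \<Longrightarrow>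
      G (Suc k) i j = G k i j - G k i k / G k k k * G k k j"
    and \<pi>: "\<pi> permutes {..<N}"
    and strict: "\<pi> = id \<or> (\<forall>k<N. \<forall>i<N. i \<noteq> k \<longrightarrow> \<bar>G k i k\<bar> < \<bar>G k k k\<bar>)"
    using tame unfolding tame_elimination_def by blast+
  have lead: "lead_max k (ge_mat gepp A k) (inv_into UNIV p k)"
    if p: "p permutes {..<N}" "\<forall>i<k. p i = i" "\<pi> = id \<longrightarrow> p = id"
      and C: "\<forall>i<N. \<forall>j<N. ge_mat gepp A k $$ (i, j) = G (min i k) (p i) j"
      and k: "k < N" for p k
  proof -
    have r: "p (inv_into UNIV p k) = k" "inv_into UNIV p k < N"
      using permutes_inverses(1)[OF p(1)] permutes_in_image[OF permutes_inv[OF p(1)], of k] k by auto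
    have kr: "k \<le> inv_into UNIV p k"
      using p(2) r(1) by (metis not_le order_less_irrefl)
    have pi: "p i < N" if "i < N" for i
      using permutes_in_image[OF p(1), of i] that by simp
    have e: "ge_mat gepp A k $$ (inv_into UNIV p k, k) = G k k k"
      using C r kr k by (simp add: min_absorb2)
    have "\<bar>ge_mat gepp A k $$ (i, k)\<bar> < \<bar>G k k k\<bar>" if i: "k \<le> i" "i < inv_into UNIV p k" for i
    proof -
      have "p \<noteq> id" using i by auto
      then have s: "\<forall>i<N. i \<noteq> k \<longrightarrow> \<bar>G k i k\<bar> < \<bar>G k k k\<bar>"
        using p(3) strict k by blast
      have "p i \<noteq> k" using i permutes_inverses(2)[OF p(1), of i] by auto
      then show ?thesis
        using s pi[of i] i r k C by (simp add: min_absorb2)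
    qed
    then show ?thesis
      unfolding lead_max_def e using r kr k C pi bd by (auto simp: dim min_absorb2)
  qed
  have "\<exists>p. p permutes {..<N} \<and> (\<forall>i<k. p i = i) \<and> (\<pi> = id \<longrightarrow> p = id) \<and>
    (\<forall>i<N. \<forall>j<N. ge_mat gepp A k $$ (i, j) = G (min i k) (p i) j)"
    using \<open>k \<le> N\<close>
  proof (induction k)
    case 0
    show ?case
      by (rule exI[of _ \<pi>]) (use \<pi> A in auto)
  next
    case (Suc k)
    then have k: "k < N" by simp
    obtain p where p: "p permutes {..<N}" "\<forall>i<k. p i = i" "\<pi> = id \<longrightarrow> p = id"
      and C: "\<forall>i<N. \<forall>j<N. ge_mat gepp A k $$ (i, j) = G (min i k) (p i) j"
      using Suc.IH[OF less_imp_le[OF k]] by blast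
    define r where "r = inv_into UNIV p k"
    have lm: "lead_max k (ge_mat gepp A k) r"
      using lead[OF p C k] by (simp add: r_def)
    have r: "p r = k" "k \<le> r" "r < N"
      using lm permutes_inverses(1)[OF p(1)] by (auto simp: lead_max_def dim r_def)
    define q where "q = p \<circ> Transposition.transpose k r"
    have q: "q permutes {..<N}"
      unfolding q_def using r k p(1) by (intro permutes_compose permutes_swap_id) auto
    have qk: "q k = k" by (simp add: q_def r)
    have qi: "q i = i" if "i < Suc k" for i
      using that p(2) r qk by (cases "i = k") (auto simp: q_def Transposition.transpose_def)
    have "q = id" if "\<pi> = id"
      using that p(3) r by (auto simp: q_def)
    moreover have "ge_mat gepp A (Suc k) $$ (i, j) = G (min i (Suc k)) (q i) j"
      if ij: "i < N" "j < N" for i j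
    proof -
      define E where "E = swaprows k r (swapcols k k (ge_mat gepp A k))"
      have E: "E $$ (i, j) = G (min i k) (q i) j" if "i < N" "j < N" for i j
        using that k r C
        by (auto simp: E_def dim q_def Transposition.transpose_def min_absorb2)
      have "q i < N" using permutes_in_image[OF q, of i] ij by simp
      then have "E $$ (i, j) - E $$ (i, k) / E $$ (k, k) * E $$ (k, j) = G (Suc k) (q i) j" if "k < i"
        using ij k qk that by (simp add: E min_absorb2 step)
      moreover have "ge_mat gepp A (Suc k) = eliminate k E"
        using gepp_lead_max[OF lm] by (simp add: E_def)
      moreover have "dim_row E = N" "dim_col E = N" by (simp_all add: E_def dim)
      ultimately show ?thesis
        using ij by (auto simp: eliminate_def E min_absorb1 min_absorb2)
    qed
    ultimately show ?case using q qi by blast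
  qed
  with lead show ?thesis by blast
qed

lemma tame_elimination_pivots:
  assumes tame: "tame_elimination N \<pi> G"
    and dim: "dim_row A = N" "dim_col A = N"
    and A: "\<And>i j. i < N \<Longrightarrow> j < N \<Longrightarrow> A $$ (i, j) = G 0 (\<pi> i) j"
    and s: "s \<in> {gepp, gerp, gecp} \<or> s = genp \<and> \<pi> = id" and k: "k < N"
  shows "ge_pivot gepp A k = s k (ge_mat gepp A k)"
    and "ge_mat gepp A k $$ ge_pivot gepp A k \<noteq> 0"
    and "\<pi> = id \<Longrightarrow> ge_pivot gepp A k = (k, k)"
proof -
  obtain p where p: "p permutes {..<N}" "\<pi> = id \<longrightarrow> p = id"
    and C: "\<forall>i<N. \<forall>j<N. ge_mat gepp A k $$ (i, j) = G (min i k) (p i) j"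
    and lm: "lead_max k (ge_mat gepp A k) (inv_into UNIV p k)"
    using ge_mat_gepp[OF tame dim A, of k] k by auto
  have piv: "ge_pivot gepp A k = (inv_into UNIV p k, k)"
    using gepp_lead_max[OF lm] by (simp add: ge_pivot_def)
  show "ge_pivot gepp A k = s k (ge_mat gepp A k)"
    using s piv p gepp_lead_max[OF lm] gerp_lead_max[OF lm] gecp_lead_max[OF lm]
    by (auto simp: genp_def)
  show "\<pi> = id \<Longrightarrow> ge_pivot gepp A k = (k, k)"
    using piv p by simp
  have "ge_mat gepp A k $$ (inv_into UNIV p k, k) = G k k k"
    using C lm k permutes_inverses(1)[OF p(1)] by (simp add: lead_max_def dim min_absorb2)
  then show "ge_mat gepp A k $$ ge_pivot gepp A k \<noteq> 0"
    using tame k unfolding piv tame_elimination_def by simp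
qed

lemma max_norm_eqI:
  assumes "i < dim_row A" "j < dim_col A" "\<bar>A $$ (i, j)\<bar> = c"
    and "\<And>i j. i < dim_row A \<Longrightarrow> j < dim_col A \<Longrightarrow> \<bar>A $$ (i, j)\<bar> \<le> c"
  shows "max_norm A = c"
  unfolding max_norm_def
proof (rule Max_eqI)
  show "c \<in> (\<lambda>ij. \<bar>A $$ ij\<bar>) ` ({..<dim_row A} \<times> {..<dim_col A})"
    using assms(1-3) by (intro image_eqI[of _ _ "(i, j)"]) auto
qed (use assms(4) in auto)

lemma max_norm_le:
  assumes "0 < dim_row A" "0 < dim_col A"
    and "\<And>i j. i < dim_row A \<Longrightarrow> j < dim_col A \<Longrightarrow> \<bar>A $$ (i, j)\<bar> \<le> c"
  shows "max_norm A \<le> c"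
  unfolding max_norm_def using assms by (subst Max_le_iff) auto

text \<open>Every entry of every intermediate matrix is an entry of some \<open>G k\<close> and so is bounded by a diagonal
pivot; the largest pivot is the last one by hypothesis, and it does appear, in the last corner of the
last matrix. The largest entry of the matrix itself is its first pivot.\<close>

lemma tame_elimination_growth:
  assumes tame: "tame_elimination N \<pi> G" and "0 < N"
    and dim: "dim_row A = N" "dim_col A = N"
    and A: "\<And>i j. i < N \<Longrightarrow> j < N \<Longrightarrow> A $$ (i, j) = G 0 (\<pi> i) j"
    and s: "s \<in> {gepp, gerp, gecp} \<or> s = genp \<and> \<pi> = id"
    and last: "\<And>k. k < N \<Longrightarrow> \<bar>G k k k\<bar> \<le> \<bar>G (N - 1) (N - 1) (N - 1)\<bar>"
  shows "growth s A = \<bar>G (N - 1) (N - 1) (N - 1)\<bar> / \<bar>G 0 0 0\<bar>"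
proof -
  let ?c = "\<bar>G (N - 1) (N - 1) (N - 1)\<bar>"
  have bd: "\<And>k i j. k < N \<Longrightarrow> i < N \<Longrightarrow> j < N \<Longrightarrow> \<bar>G k i j\<bar> \<le> \<bar>G k k k\<bar>"
    and \<pi>: "\<pi> permutes {..<N}"
    using tame unfolding tame_elimination_def by blast+
  have mat: "ge_mat s A k = ge_mat gepp A k" if "k < N" for k
    by (rule ge_same_pivots(1)[of N])
       (use tame_elimination_pivots(1)[OF tame dim A s] that in auto)
  have entry: "\<exists>p. p permutes {..<N} \<and> (\<forall>i<k. p i = i) \<and>
      (\<forall>i<N. \<forall>j<N. ge_mat s A k $$ (i, j) = G (min i k) (p i) j)" if "k < N" for k
    using ge_mat_gepp[OF tame dim A, of k] that unfolding mat[OF that] by auto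
  have le: "\<bar>ge_mat s A k $$ (i, j)\<bar> \<le> ?c" if "k < N" "i < N" "j < N" for k i j
  proof -
    obtain p where p: "p permutes {..<N}" "ge_mat s A k $$ (i, j) = G (min i k) (p i) j"
      using entry[OF \<open>k < N\<close>] \<open>i < N\<close> \<open>j < N\<close> by blast
    have "p i < N" using permutes_in_image[OF p(1), of i] \<open>i < N\<close> by simp
    moreover have "min i k < N" using that by simp
    ultimately show ?thesis
      unfolding p(2) using order_trans[OF bd last] that(3) by blast
  qed
  have max_le: "max_norm (ge_mat s A k) \<le> ?c" if "k < N" for k
    by (rule max_norm_le) (use le that dim \<open>0 < N\<close> in auto)
  have max_last: "max_norm (ge_mat s A (N - 1)) = ?c"
  proof (rule max_norm_eqI)
    obtain p where p: "p permutes {..<N}" "\<forall>i<N - 1. p i = i"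
      "\<forall>i<N. \<forall>j<N. ge_mat s A (N - 1) $$ (i, j) = G (min i (N - 1)) (p i) j"
      using entry[of "N - 1"] \<open>0 < N\<close> by auto
    have "p (N - 1) = N - 1"
    proof (rule ccontr)
      assume *: "p (N - 1) \<noteq> N - 1"
      moreover have "p (N - 1) < N"
        using permutes_in_image[OF p(1), of "N - 1"] \<open>0 < N\<close> by simp
      ultimately have "p (p (N - 1)) = p (N - 1)" using p(2) by auto
      then show False using permutes_inj[OF p(1)] * by (metis injD)
    qed
    then show "\<bar>ge_mat s A (N - 1) $$ (N - 1, N - 1)\<bar> = ?c"
      using p(3) \<open>0 < N\<close> by simp
  qed (use le dim \<open>0 < N\<close> in auto)
  have "Max ((\<lambda>k. max_norm (ge_mat s A k)) ` {..<N}) = ?c"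
  proof (rule Max_eqI)
    show "?c \<in> (\<lambda>k. max_norm (ge_mat s A k)) ` {..<N}"
      using max_last \<open>0 < N\<close> by (intro image_eqI[of _ _ "N - 1"]) auto
  qed (use max_le in auto)
  moreover have "max_norm A = \<bar>G 0 0 0\<bar>"
  proof (rule max_norm_eqI)
    show "inv_into UNIV \<pi> 0 < dim_row A"
      using permutes_in_image[OF permutes_inv[OF \<pi>], of 0] \<open>0 < N\<close> dim by simp
    then show "\<bar>A $$ (inv_into UNIV \<pi> 0, 0)\<bar> = \<bar>G 0 0 0\<bar>"
      using A \<open>0 < N\<close> dim permutes_inverses(1)[OF \<pi>, of 0] by simp
    show "\<bar>A $$ (i, j)\<bar> \<le> \<bar>G 0 0 0\<bar>" if "i < dim_row A" "j < dim_col A" for i j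
      using that bd[of 0 "\<pi> i" j] A[of i j] dim permutes_in_image[OF \<pi>, of i] by simp
  qed (use \<open>0 < N\<close> dim in auto)
  ultimately show ?thesis
    by (simp add: growth_def dim)
qed

lemma tame_elimination_align:
  assumes tame: "tame_elimination N \<pi> G"
    and dim: "dim_row A = N" "dim_col A = N"
    and A: "\<And>i j. i < N \<Longrightarrow> j < N \<Longrightarrow> A $$ (i, j) = G 0 (\<pi> i) j"
    and S: "\<And>s. s \<in> S \<Longrightarrow> s \<in> {gepp, gerp, gecp} \<or> s = genp \<and> \<pi> = id"
  shows "factorizations_align S A"
  unfolding factorizations_align_def
proof (intro exI ballI)
  fix s assume "s \<in> S"
  note piv = tame_elimination_pivots[OF tame dim A S[OF this]]
  note same = ge_same_pivots[of N gepp A s, OF piv(1)]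
  have "ge_mat s A k $$ ge_pivot s A k \<noteq> 0" if "k < N" for k
    using piv[OF _ _ that] same(1)[of k] that by (simp add: ge_pivot_def)
  then show "ge_factors s A = Some (ge_row_perm gepp A (N - 1), ge_col_perm gepp A (N - 1),
      1\<^sub>m N + ge_mult gepp A (N - 1), ge_mat gepp A (N - 1))"
    using same[where k = "N - 1"] by (simp add: ge_factors_def dim Let_def)
qed

section \<open>Elimination of butterfly matrices\<close>

text \<open>The parameter \<open>t\<close> in \<open>[-1, 1]\<close> for which the rotation matrix is, up to the order of its rows and a
factor for each row, $\begin{pmatrix}1 & t\cr -t & 1\end{pmatrix}$. If the sine dominates, the
two rows have to be exchanged, and the sign in the second case comes from that.\<close>

definition skew :: "real \<Rightarrow> real" where
  "skew \<theta> = (if \<bar>sin \<theta>\<bar> \<le> \<bar>cos \<theta>\<bar> then sin \<theta> / cos \<theta> else - cos \<theta> / sin \<theta>)"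

lemma cos_nonzero_if_dominant: "\<bar>sin \<theta>\<bar> \<le> \<bar>cos \<theta>\<bar> \<Longrightarrow> cos \<theta> \<noteq> (0::real)"
  using sin_zero_norm_cos_one by fastforce

lemma abs_skew: "\<bar>skew \<theta>\<bar> = min \<bar>tan \<theta>\<bar> \<bar>cot \<theta>\<bar>"
proof (cases "\<bar>sin \<theta>\<bar> \<le> \<bar>cos \<theta>\<bar>")
  case True
  then have c: "0 < \<bar>cos \<theta>\<bar>" using cos_nonzero_if_dominant by simp
  have "\<bar>tan \<theta>\<bar> \<le> \<bar>cot \<theta>\<bar>"
  proof (cases "sin \<theta> = 0")
    case False
    have "\<bar>sin \<theta>\<bar> * \<bar>sin \<theta>\<bar> \<le> \<bar>cos \<theta>\<bar> * \<bar>cos \<theta>\<bar>"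
      using True by (intro mult_mono) auto
    then show ?thesis
      using False c by (simp add: tan_def cot_def abs_divide field_simps)
  qed (simp add: tan_def)
  then show ?thesis
    using True by (simp add: skew_def tan_def)
next
  case False
  then have s: "0 < \<bar>sin \<theta>\<bar>" by linarith
  have "\<bar>cot \<theta>\<bar> \<le> \<bar>tan \<theta>\<bar>"
  proof (cases "cos \<theta> = 0")
    case c: False
    have "\<bar>cos \<theta>\<bar> * \<bar>cos \<theta>\<bar> \<le> \<bar>sin \<theta>\<bar> * \<bar>sin \<theta>\<bar>"
      using False by (intro mult_mono) auto
    then show ?thesis
      using c s by (simp add: tan_def cot_def abs_divide field_simps)
  qed (simp add: cot_def)
  then show ?thesis
    using False by (simp add: skew_def cot_def)
qed

lemma abs_skew_le_1: "\<bar>skew \<theta>\<bar> \<le> 1"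
proof (cases "\<bar>sin \<theta>\<bar> \<le> \<bar>cos \<theta>\<bar>")
  case True
  then show ?thesis
    using cos_nonzero_if_dominant[OF True] by (simp add: skew_def abs_divide)
next
  case False
  then have "0 < \<bar>sin \<theta>\<bar>" by linarith
  then show ?thesis
    using False by (simp add: skew_def abs_divide)
qed

lemma rot_index:
  "rot \<theta> $$ (of_bool a, of_bool b) =
     (if a = b then cos \<theta> else if a then - sin \<theta> else sin \<theta>)"
  by (cases a; cases b) (simp_all add: rot_def mat_of_rows_list_def)

text \<open>The factors of the rows have equal magnitude, the larger one of \<open>\<bar>cos \<theta>\<bar>\<close> and \<open>\<bar>sin \<theta>\<bar>\<close>.\<close>

lemma rot_skew:
  assumes "flip \<longleftrightarrow> \<bar>cos \<theta>\<bar> < \<bar>sin \<theta>\<bar>"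
  shows "rot \<theta> $$ (of_bool a, of_bool b) =
     (if \<not> flip then cos \<theta> else if a then - sin \<theta> else sin \<theta>) *
       rot_entry (skew \<theta>) (a \<noteq> flip) b"
proof (cases flip)
  case True
  then have "sin \<theta> \<noteq> 0" using assms by auto
  then show ?thesis
    using True assms unfolding rot_index by (auto simp: skew_def)
next
  case False
  then have "cos \<theta> \<noteq> 0" using assms cos_nonzero_if_dominant by simp
  then show ?thesis
    using False assms unfolding rot_index by (auto simp: skew_def)
qed

lemma butterfly_dim [simp]:
  "dim_row (butterfly n \<theta>) = 2 ^ n" "dim_col (butterfly n \<theta>) = 2 ^ n"
  by (induction n) (simp_all add: kron_def rot_def mat_of_rows_list_def)

lemma butterfly_Suc_index:
  assumes "i < 2 ^ Suc n" "j < 2 ^ Suc n"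
  shows "butterfly (Suc n) \<theta> $$ (i, j) =
    rot (\<theta> (Suc n)) $$ (of_bool (2 ^ n \<le> i), of_bool (2 ^ n \<le> j)) *
      butterfly n \<theta> $$ (i mod 2 ^ n, j mod 2 ^ n)"
proof -
  have "l div 2 ^ n = of_bool (2 ^ n \<le> l)" if "l < 2 ^ Suc n" for l :: nat
    using that by (cases "2 ^ n \<le> l") (auto simp: div_if)
  then show ?thesis
    using assms by (simp add: kron_def rot_def mat_of_rows_list_def)
qed

text \<open>The row permutation of a Kronecker product that exchanges the two halves if \<open>flip\<close> holds and
acts by \<open>\<pi>\<close> inside each half.\<close>

definition lift_row_perm :: "nat \<Rightarrow> bool \<Rightarrow> (nat \<Rightarrow> nat) \<Rightarrow> nat \<Rightarrow> nat" where
  "lift_row_perm N flip \<pi> i =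
     (if i < 2 * N then (if (N \<le> i) \<noteq> flip then N else 0) + \<pi> (i mod N) else i)"

lemma lift_row_perm:
  assumes "\<pi> permutes {..<N}" "i < 2 * N"
  shows "lift_row_perm N flip \<pi> i < 2 * N"
    and "N \<le> lift_row_perm N flip \<pi> i \<longleftrightarrow> (N \<le> i) \<noteq> flip"
    and "lift_row_perm N flip \<pi> i mod N = \<pi> (i mod N)"
proof -
  have "i mod N < N" using assms(2) by (cases "N = 0") auto
  then have "\<pi> (i mod N) < N"
    using permutes_in_image[OF assms(1), of "i mod N"] by simp
  then show "lift_row_perm N flip \<pi> i < 2 * N"
    and "N \<le> lift_row_perm N flip \<pi> i \<longleftrightarrow> (N \<le> i) \<noteq> flip"
    and "lift_row_perm N flip \<pi> i mod N = \<pi> (i mod N)"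
    using assms(2) by (auto simp: lift_row_perm_def)
qed

lemma lift_row_perm_permutes:
  assumes "\<pi> permutes {..<N}"
  shows "lift_row_perm N flip \<pi> permutes {..<2 * N}"
proof (rule inj_imp_permutes)
  show "inj_on (lift_row_perm N flip \<pi>) {..<2 * N}"
  proof (rule inj_onI)
    fix i j assume ij: "i \<in> {..<2 * N}" "j \<in> {..<2 * N}"
      and eq: "lift_row_perm N flip \<pi> i = lift_row_perm N flip \<pi> j"
    note i = lift_row_perm[OF assms, of i flip] and j = lift_row_perm[OF assms, of j flip]
    have "i mod N = j mod N"
      using i(3) j(3) ij eq permutes_inj[OF assms] by (metis injD lessThan_iff)
    moreover have "N \<le> i \<longleftrightarrow> N \<le> j"
      using i(2) j(2) ij eq by (metis lessThan_iff)
    ultimately show "i = j"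
      using ij by (cases "N \<le> i") (auto simp: le_mod_geq)
  qed
qed (use lift_row_perm(1)[OF assms] in \<open>auto simp: lift_row_perm_def\<close>)

lemma lift_row_perm_id: "lift_row_perm N False id = id"
  by (auto simp: lift_row_perm_def fun_eq_iff le_mod_geq)

lemma butterfly_row_perm:
  "\<exists>\<pi> w. \<pi> permutes {..<2 ^ n} \<and>
     (\<forall>i<2 ^ n. \<bar>w i\<bar> = (\<Prod>j\<in>{1..n}. max \<bar>cos (\<theta> j)\<bar> \<bar>sin (\<theta> j)\<bar>)) \<and>
     (\<forall>i<2 ^ n. \<forall>j<2 ^ n. butterfly n \<theta> $$ (i, j) = w (\<pi> i) * normalized_kron n (skew \<circ> \<theta>) (\<pi> i) j) \<and>
     ((\<forall>j\<in>{1..n}. \<bar>sin (\<theta> j)\<bar> \<le> \<bar>cos (\<theta> j)\<bar>) \<longrightarrow> \<pi> = id)"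
proof (induction n)
  case 0
  show ?case by (intro exI[of _ id] exI[of _ "\<lambda>_. 1"]) (auto simp: permutes_def)
next
  case (Suc n)
  then obtain \<pi> w where \<pi>: "\<pi> permutes {..<2 ^ n}"
    and w: "\<And>i. i < 2 ^ n \<Longrightarrow> \<bar>w i\<bar> = (\<Prod>j\<in>{1..n}. max \<bar>cos (\<theta> j)\<bar> \<bar>sin (\<theta> j)\<bar>)"
    and B: "\<And>i j. i < 2 ^ n \<Longrightarrow> j < 2 ^ n \<Longrightarrow>
      butterfly n \<theta> $$ (i, j) = w (\<pi> i) * normalized_kron n (skew \<circ> \<theta>) (\<pi> i) j"
    and id: "(\<forall>j\<in>{1..n}. \<bar>sin (\<theta> j)\<bar> \<le> \<bar>cos (\<theta> j)\<bar>) \<longrightarrow> \<pi> = id"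
    by blast
  define \<phi> flip \<pi>' where "\<phi> = \<theta> (Suc n)" and "flip \<longleftrightarrow> \<bar>cos \<phi>\<bar> < \<bar>sin \<phi>\<bar>"
    and "\<pi>' = lift_row_perm (2 ^ n) flip \<pi>"
  define v where "v a = (if \<not> flip then cos \<phi> else if a then sin \<phi> else - sin \<phi>)" for a
  define w' where "w' i = v (2 ^ n \<le> i) * w (i mod 2 ^ n)" for i
  note \<pi>'_props = lift_row_perm[OF \<pi>, of _ flip, folded \<pi>'_def power_Suc]
  have "\<bar>w' i\<bar> = (\<Prod>j\<in>{1..Suc n}. max \<bar>cos (\<theta> j)\<bar> \<bar>sin (\<theta> j)\<bar>)" for i
  proof -
    have "\<bar>v (2 ^ n \<le> i)\<bar> = max \<bar>cos \<phi>\<bar> \<bar>sin \<phi>\<bar>"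
      by (auto simp: v_def flip_def)
    then show ?thesis
      by (simp add: w'_def abs_mult w \<phi>_def)
  qed
  moreover have "butterfly (Suc n) \<theta> $$ (i, j) = w' (\<pi>' i) * normalized_kron (Suc n) (skew \<circ> \<theta>) (\<pi>' i) j"
    if ij: "i < 2 ^ Suc n" "j < 2 ^ Suc n" for i j
  proof -
    have "butterfly (Suc n) \<theta> $$ (i, j) =
        (v (2 ^ n \<le> \<pi>' i) * rot_entry (skew \<phi>) (2 ^ n \<le> \<pi>' i) (2 ^ n \<le> j)) *
        (w (\<pi>' i mod 2 ^ n) * normalized_kron n (skew \<circ> \<theta>) (\<pi>' i mod 2 ^ n) (j mod 2 ^ n))"
      unfolding butterfly_Suc_index[OF ij] \<phi>_def[symmetric] rot_skew[OF flip_def]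
      using \<pi>'_props[OF ij(1)] B[of "i mod 2 ^ n" "j mod 2 ^ n"] by (auto simp: v_def)
    then show ?thesis
      by (simp add: w'_def \<phi>_def)
  qed
  moreover have "\<pi>' permutes {..<2 ^ Suc n}"
    using lift_row_perm_permutes[OF \<pi>] by (simp add: \<pi>'_def)
  moreover have "\<pi>' = id" if "\<forall>j\<in>{1..Suc n}. \<bar>sin (\<theta> j)\<bar> \<le> \<bar>cos (\<theta> j)\<bar>"
  proof -
    have "\<not> flip" "\<pi> = id"
      using that id by (auto simp: flip_def \<phi>_def not_less)
    then show ?thesis by (simp add: \<pi>'_def lift_row_perm_id)
  qed
  ultimately show ?case by blast
qed

text \<open>Multiplying the rows of a matrix by factors of the same magnitude affects neither the dominance of
the pivots nor the elimination steps, so the estimates for \<open>schur\<close> carry over. The row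
permutation is the identity unless some sine dominates, and in that case ties are excluded.\<close>

lemma butterfly_tame_elimination:
  assumes ordered: "\<forall>j\<in>{1..<n}. \<bar>skew (\<theta> (j + 1))\<bar> \<le> \<bar>skew (\<theta> j)\<bar>"
    and no_ties: "(\<forall>j\<in>{1..n}. \<bar>sin (\<theta> j)\<bar> \<le> \<bar>cos (\<theta> j)\<bar>) \<or> (\<forall>j\<in>{1..n}. \<bar>skew (\<theta> j)\<bar> < 1)"
  shows "\<exists>\<pi> G. tame_elimination (2 ^ n) \<pi> G \<and>
    (\<forall>i<2 ^ n. \<forall>j<2 ^ n. butterfly n \<theta> $$ (i, j) = G 0 (\<pi> i) j) \<and>
    ((\<forall>j\<in>{1..n}. \<bar>sin (\<theta> j)\<bar> \<le> \<bar>cos (\<theta> j)\<bar>) \<longrightarrow> \<pi> = id) \<and>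
    (\<forall>k<2 ^ n. \<bar>G k k k\<bar> \<le> \<bar>G (2 ^ n - 1) (2 ^ n - 1) (2 ^ n - 1)\<bar>) \<and>
    \<bar>G (2 ^ n - 1) (2 ^ n - 1) (2 ^ n - 1)\<bar> / \<bar>G 0 0 0\<bar> = (\<Prod>j\<in>{1..n}. 1 + (skew (\<theta> j))\<^sup>2)"
proof -
  obtain \<pi> w where \<pi>: "\<pi> permutes {..<2 ^ n}"
    and w: "\<And>i. i < 2 ^ n \<Longrightarrow> \<bar>w i\<bar> = (\<Prod>j\<in>{1..n}. max \<bar>cos (\<theta> j)\<bar> \<bar>sin (\<theta> j)\<bar>)"
    and B: "\<And>i j. i < 2 ^ n \<Longrightarrow> j < 2 ^ n \<Longrightarrow>
      butterfly n \<theta> $$ (i, j) = w (\<pi> i) * normalized_kron n (skew \<circ> \<theta>) (\<pi> i) j"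
    and id: "(\<forall>j\<in>{1..n}. \<bar>sin (\<theta> j)\<bar> \<le> \<bar>cos (\<theta> j)\<bar>) \<Longrightarrow> \<pi> = id"
    using butterfly_row_perm[of n \<theta>] by blast
  define t where "t = skew \<circ> \<theta>"
  define G where "G k i j = w i * schur n t k i j" for k i j
  define c where "c = (\<Prod>j\<in>{1..n}. max \<bar>cos (\<theta> j)\<bar> \<bar>sin (\<theta> j)\<bar>)"
  have "0 < c"
    unfolding c_def
    by (intro prod_pos) (metis cos_nonzero_if_dominant less_max_iff_disj linorder_le_cases zero_less_abs_iff)
  have t_mono: "\<bar>t j\<bar> \<le> \<bar>t i\<bar>" if "1 \<le> i" "i \<le> j" "j \<le> n" for i j
    using that(2,1,3)
  proof (induction j rule: dec_induct)
    case (step j)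
    then have "\<bar>t (j + 1)\<bar> \<le> \<bar>t j\<bar>"
      using ordered by (auto simp: t_def)
    then show ?case using step by simp
  qed simp
  have t_le: "\<bar>t j\<bar> \<le> 1" for j by (simp add: t_def abs_skew_le_1)
  have bound: "\<bar>schur n t k i j\<bar> \<le> schur n t k k k" if "k < 2 ^ n" "i < 2 ^ n" "j < 2 ^ n" for k i j
    using schur_bound[of n t k i j 0] t_mono t_le that by auto
  have pos: "1 \<le> schur n t k k k" if "k < 2 ^ n" for k
    using pivot_ge_1[OF that] .
  have absG: "\<bar>G k i j\<bar> = c * \<bar>schur n t k i j\<bar>" if "i < 2 ^ n" for k i j
    using w[OF that] by (simp add: G_def abs_mult c_def)
  have diag: "\<bar>G k k k\<bar> = c * schur n t k k k" if "k < 2 ^ n" for k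
    using absG[OF that] pos[OF that] by simp
  have "tame_elimination (2 ^ n) \<pi> G"
    unfolding tame_elimination_def
  proof (intro conjI allI impI)
    fix k :: nat assume k: "k < 2 ^ n"
    have "0 < c * schur n t k k k" using \<open>0 < c\<close> pos[OF k] by simp
    then show nz: "G k k k \<noteq> 0" using diag[OF k] by linarith
    fix i j :: nat assume ij: "i < 2 ^ n" "j < 2 ^ n"
    show "\<bar>G k i j\<bar> \<le> \<bar>G k k k\<bar>"
      unfolding absG[OF ij(1)] diag[OF k] using bound[OF k ij] \<open>0 < c\<close> by simp
    have "w k \<noteq> 0" using nz by (auto simp: G_def)
    then show "G (Suc k) i j = G k i j - G k i k / G k k k * G k k j"
      using schur_step[OF k ij, of t] by (simp add: G_def right_diff_distrib)
  next
    show "\<pi> = id \<or> (\<forall>k<2 ^ n. \<forall>i<2 ^ n. i \<noteq> k \<longrightarrow> \<bar>G k i k\<bar> < \<bar>G k k k\<bar>)"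
      using no_ties
    proof
      assume *: "\<forall>j\<in>{1..n}. \<bar>skew (\<theta> j)\<bar> < 1"
      have "\<bar>G k i k\<bar> < \<bar>G k k k\<bar>" if "k < 2 ^ n" "i < 2 ^ n" "i \<noteq> k" for k i
        unfolding absG[OF that(2)] diag[OF that(1)]
        using schur_col_strict[of n t k i] that * \<open>0 < c\<close> by (simp add: t_def)
      then show ?thesis by blast
    qed (use id in blast)
  qed (rule \<pi>)
  moreover have "butterfly n \<theta> $$ (i, j) = G 0 (\<pi> i) j" if "i < 2 ^ n" "j < 2 ^ n" for i j
    using B[OF that] by (simp add: G_def schur_0 t_def)
  moreover have "\<bar>G k k k\<bar> \<le> \<bar>G (2 ^ n - 1) (2 ^ n - 1) (2 ^ n - 1)\<bar>" if "k < 2 ^ n" for k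
    using pivot_le[OF that, of t] \<open>0 < c\<close> by (simp add: diag that last_pivot del: One_nat_def)
  moreover have "\<bar>G (2 ^ n - 1) (2 ^ n - 1) (2 ^ n - 1)\<bar> / \<bar>G 0 0 0\<bar> = (\<Prod>j\<in>{1..n}. 1 + (skew (\<theta> j))\<^sup>2)"
  proof -
    have "normalized_kron n t 0 0 = 1" by (induction n) auto
    then show ?thesis
      using \<open>0 < c\<close> by (simp add: diag last_pivot schur_0 t_def del: One_nat_def)
  qed
  ultimately show ?thesis using id by blast
qed

lemma butterfly_elimination:
  assumes "\<forall>j\<in>{1..<n}. \<bar>skew (\<theta> (j + 1))\<bar> \<le> \<bar>skew (\<theta> j)\<bar>"
    and "(\<forall>j\<in>{1..n}. \<bar>sin (\<theta> j)\<bar> \<le> \<bar>cos (\<theta> j)\<bar>) \<or> (\<forall>j\<in>{1..n}. \<bar>skew (\<theta> j)\<bar> < 1)"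
    and S: "\<And>s. s \<in> S \<Longrightarrow>
      s \<in> {gepp, gerp, gecp} \<or> s = genp \<and> (\<forall>j\<in>{1..n}. \<bar>sin (\<theta> j)\<bar> \<le> \<bar>cos (\<theta> j)\<bar>)"
  shows "factorizations_align S (butterfly n \<theta>)"
    and "s \<in> S \<Longrightarrow> growth s (butterfly n \<theta>) = (\<Prod>j\<in>{1..n}. 1 + (skew (\<theta> j))\<^sup>2)"
    and "\<forall>j\<in>{1..n}. \<bar>sin (\<theta> j)\<bar> \<le> \<bar>cos (\<theta> j)\<bar> \<Longrightarrow> completely_pivoted (butterfly n \<theta>)"
proof -
  obtain \<pi> G where tame: "tame_elimination (2 ^ n) \<pi> G"
    and B: "\<And>i j. i < 2 ^ n \<Longrightarrow> j < 2 ^ n \<Longrightarrow> butterfly n \<theta> $$ (i, j) = G 0 (\<pi> i) j"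
    and id: "(\<forall>j\<in>{1..n}. \<bar>sin (\<theta> j)\<bar> \<le> \<bar>cos (\<theta> j)\<bar>) \<Longrightarrow> \<pi> = id"
    and last: "\<And>k. k < 2 ^ n \<Longrightarrow> \<bar>G k k k\<bar> \<le> \<bar>G (2 ^ n - 1) (2 ^ n - 1) (2 ^ n - 1)\<bar>"
      "\<bar>G (2 ^ n - 1) (2 ^ n - 1) (2 ^ n - 1)\<bar> / \<bar>G 0 0 0\<bar> = (\<Prod>j\<in>{1..n}. 1 + (skew (\<theta> j))\<^sup>2)"
    using butterfly_tame_elimination[OF assms(1,2)] by blast
  have S': "s \<in> {gepp, gerp, gecp} \<or> s = genp \<and> \<pi> = id" if "s \<in> S" for s
    using S[OF that] id by blast
  show "factorizations_align S (butterfly n \<theta>)"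
    by (rule tame_elimination_align[OF tame _ _ B S']) auto
  show "growth s (butterfly n \<theta>) = (\<Prod>j\<in>{1..n}. 1 + (skew (\<theta> j))\<^sup>2)" if "s \<in> S"
    by (subst tame_elimination_growth[OF tame _ _ _ _ S'[OF that]]) (use B last in auto)
  show "completely_pivoted (butterfly n \<theta>)" if "\<forall>j\<in>{1..n}. \<bar>sin (\<theta> j)\<bar> \<le> \<bar>cos (\<theta> j)\<bar>"
    unfolding completely_pivoted_def
  proof (intro allI impI)
    fix k assume "k < dim_row (butterfly n \<theta>) - 1"
    then have k: "k < 2 ^ n" by simp
    have piv: "ge_pivot gepp (butterfly n \<theta>) k = gecp k (ge_mat gepp (butterfly n \<theta>) k)"
      if "k < 2 ^ n" for k
      by (rule tame_elimination_pivots(1)[OF tame _ _ _ _ that]) (use B in auto)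
    have "ge_pivot gepp (butterfly n \<theta>) k = (k, k)"
      by (rule tame_elimination_pivots(3)[OF tame _ _ _ _ k, of _ gepp]) (use B id that in auto)
    moreover have "ge_mat gecp (butterfly n \<theta>) k = ge_mat gepp (butterfly n \<theta>) k"
      by (rule ge_same_pivots(1)[of "2 ^ n"]) (use piv k in auto)
    ultimately show "ge_pivot gecp (butterfly n \<theta>) k = (k, k)"
      using piv[OF k] by (simp add: ge_pivot_def)
  qed
qed

section \<open>The law of the growth factor\<close>

lemma skew_measurable [measurable]: "skew \<in> borel_measurable borel"
proof -
  have [measurable]: "(sin :: real \<Rightarrow> real) \<in> borel_measurable borel" "(cos :: real \<Rightarrow> real) \<in> borel_measurable borel"
    by (intro borel_measurable_continuous_onI continuous_intros)+
  show ?thesis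
    unfolding skew_def[abs_def] by measurable
qed

lemma abs_skew_add_quarter: "\<bar>skew (\<theta> + of_nat q * (pi / 2))\<bar> = \<bar>skew \<theta>\<bar>"
proof (induction q)
  case (Suc q)
  have *: "\<theta> + of_nat (Suc q) * (pi / 2) = \<theta> + of_nat q * (pi / 2) + pi / 2"
    by (simp add: algebra_simps)
  have "\<bar>skew (\<phi> + pi / 2)\<bar> = \<bar>skew \<phi>\<bar>" for \<phi>
    by (simp add: abs_skew tan_def cot_def sin_add cos_add min.commute abs_divide)
  then show ?case unfolding * using Suc by simp
qed simp

text \<open>On the first quadrant the smaller one of tangent and cotangent is at most \<open>x\<close> near either end,
up to distance \<open>arctan x\<close>.\<close>

lemma abs_skew_le_iff:
  assumes "0 \<le> \<theta>" "\<theta> < pi / 2" "0 \<le> x"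
  shows "\<bar>skew \<theta>\<bar> \<le> x \<longleftrightarrow> \<theta> \<le> arctan x \<or> pi / 2 - arctan x \<le> \<theta>"
proof -
  have tan: "\<bar>tan \<phi>\<bar> \<le> x \<longleftrightarrow> \<phi> \<le> arctan x" if "0 \<le> \<phi>" "\<phi> < pi / 2" for \<phi>
  proof -
    have "0 \<le> tan \<phi>"
      using that tan_gt_zero[of \<phi>] by (cases "\<phi> = 0") auto
    then have "\<bar>tan \<phi>\<bar> \<le> x \<longleftrightarrow> arctan (tan \<phi>) \<le> arctan x"
      by (simp add: arctan_le_iff)
    also have "arctan (tan \<phi>) = \<phi>"
      using that by (intro arctan_tan) auto
    finally show ?thesis .
  qed
  show ?thesis
  proof (cases "\<theta> = 0")
    case False
    then have "\<bar>cot \<theta>\<bar> \<le> x \<longleftrightarrow> pi / 2 - \<theta> \<le> arctan x"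
      using tan[of "pi / 2 - \<theta>"] assms by (simp add: tan_cot')
    then show ?thesis
      using tan[OF assms(1,2)] by (auto simp: abs_skew min_le_iff_disj)
  qed (use assms in \<open>simp add: skew_def\<close>)
qed

abbreviation uniform_angle :: "real measure" where
  "uniform_angle \<equiv> uniform_measure lborel {0..<2 * pi}"

lemma prob_space_uniform_angle: "prob_space uniform_angle"
  by (rule prob_space_uniform_measure) auto

text \<open>By periodicity each of the four quadrants contributes two intervals of length \<open>arctan x\<close>. They
are disjoint because \<open>arctan x < pi / 4\<close>.\<close>

lemma emeasure_abs_skew_le:
  assumes "0 \<le> x" "x < 1"
  shows "emeasure lborel ({0..<2 * pi} \<inter> {\<theta>. \<bar>skew \<theta>\<bar> \<le> x}) = ennreal (8 * arctan x)"
proof -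
  define a where "a = arctan x"
  have "a < pi / 4"
    unfolding a_def arctan_one[symmetric] arctan_less_iff by fact
  then have a: "0 \<le> a" "a < pi / 4" using assms by (auto simp: a_def)
  define A where "A q = {of_nat q * (pi / 2)..<of_nat (Suc q) * (pi / 2)} \<inter> {\<theta>. \<bar>skew \<theta>\<bar> \<le> x}" for q :: nat
  have A: "emeasure lborel (A q) = ennreal (2 * a)" for q
  proof -
    define b where "b = of_nat q * (pi / 2)"
    have b: "of_nat (Suc q) * (pi / 2) = b + pi / 2" by (simp add: b_def algebra_simps)
    have "\<bar>skew \<theta>\<bar> \<le> x \<longleftrightarrow> \<theta> \<le> b + a \<or> b + pi / 2 - a \<le> \<theta>" if "b \<le> \<theta>" "\<theta> < b + pi / 2" for \<theta>
      using abs_skew_le_iff[of "\<theta> - b" x] abs_skew_add_quarter[of "\<theta> - b" q] that assms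
      by (auto simp: b_def a_def)
    then have "A q = {b..b + a} \<union> {b + pi / 2 - a..<b + pi / 2}"
      using a unfolding A_def b b_def[symmetric] by force
    moreover have "emeasure lborel ({b..b + a} \<union> {b + pi / 2 - a..<b + pi / 2})
        = emeasure lborel {b..b + a} + emeasure lborel {b + pi / 2 - a..<b + pi / 2}"
      using a by (intro plus_emeasure[symmetric]) auto
    ultimately show ?thesis
      using a by (simp flip: ennreal_plus)
  qed
  have disj: "disjoint_family_on A {..<4}"
    unfolding disjoint_family_on_def
  proof (intro ballI impI)
    fix q r :: nat assume "q \<noteq> r"
    then show "A q \<inter> A r = {}"
    proof (induction q r rule: linorder_wlog)
      case (le q r)
      then have "of_nat (Suc q) * (pi / 2) \<le> of_nat r * (pi / 2)"
        by (intro mult_right_mono) auto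
      then show ?case
        unfolding A_def disjoint_iff Int_iff atLeastLessThan_iff by (meson leD less_le_trans)
    qed auto
  qed
  have split: "{0..<2 * pi} = (\<Union>q<4. {of_nat q * (pi / 2)..<of_nat (Suc q) * (pi / 2)})"
    by (auto simp: numeral_eq_Suc lessThan_Suc)
  have "A q \<in> sets lborel" for q
    unfolding A_def by auto
  then have "emeasure lborel (\<Union>q<4. A q) = (\<Sum>q<4. emeasure lborel (A q))"
    using disj by (intro sum_emeasure[symmetric]) auto
  also have "\<dots> = ennreal (8 * a)"
    using a unfolding A by (subst sum_ennreal) auto
  also have "(\<Union>q<4. A q) = {0..<2 * pi} \<inter> {\<theta>. \<bar>skew \<theta>\<bar> \<le> x}"
    unfolding split A_def by auto
  finally show ?thesis by (simp add: a_def)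
qed

lemma sets_std_cauchy [simp, measurable_cong]: "sets std_cauchy = sets borel"
  by (simp add: std_cauchy_def)

lemma emeasure_cond_abs_cauchy:
  assumes "A \<in> sets borel"
  shows "emeasure cond_abs_cauchy A =
    emeasure std_cauchy ({-1..1} \<inter> {x. \<bar>x\<bar> \<in> A}) / emeasure std_cauchy {-1..1}"
proof -
  have "{x. \<bar>x\<bar> \<le> 1} = {-1..1 :: real}" by auto
  moreover have "{x. \<bar>x\<bar> \<in> A} \<in> sets borel"
    using assms by measurable
  ultimately show ?thesis
    using assms by (simp add: cond_abs_cauchy_def emeasure_distr vimage_def)
qed

lemma emeasure_std_cauchy:
  assumes "0 \<le> x"
  shows "emeasure std_cauchy {-x..x} = ennreal (2 * arctan x / pi)"
proof -
  have "emeasure std_cauchy {-x..x}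
      = (\<integral>\<^sup>+y. ennreal (1 / (pi * (1 + y\<^sup>2))) * indicator {-x..x} y \<partial>lborel)"
    unfolding std_cauchy_def by (subst emeasure_density) auto
  also have "\<dots> = ennreal (arctan x / pi - arctan (- x) / pi)"
  proof (rule nn_integral_FTC_Icc)
    fix y :: real
    show "((\<lambda>y. arctan y / pi) has_real_derivative 1 / (pi * (1 + y\<^sup>2))) (at y)"
      by (rule DERIV_cdivide[OF DERIV_arctan, THEN DERIV_cong]) (simp add: divide_inverse)
  qed (use assms in auto)
  finally show ?thesis by (simp add: arctan_minus)
qed

lemma cond_abs_cauchy_space:
  "prob_space (uniform_measure std_cauchy {x. \<bar>x\<bar> \<le> 1})"
  "prob_space cond_abs_cauchy" "sets cond_abs_cauchy = sets borel"
proof -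
  have "{x. \<bar>x\<bar> \<le> 1} = {- 1..1 :: real}" by auto
  then have "emeasure std_cauchy {x. \<bar>x\<bar> \<le> 1} = ennreal (1 / 2)"
    using emeasure_std_cauchy[of 1] by (simp add: arctan_one)
  then show "prob_space (uniform_measure std_cauchy {x. \<bar>x\<bar> \<le> 1})"
    by (intro prob_space_uniform_measure) auto
  then show "prob_space cond_abs_cauchy"
    unfolding cond_abs_cauchy_def by (rule prob_space.prob_space_distr) (simp add: std_cauchy_def)
qed (simp add: cond_abs_cauchy_def)

lemma cond_abs_cauchy_cdf:
  "measure cond_abs_cauchy {..x} = (if x < 0 then 0 else 4 * arctan (min 1 x) / pi)"
proof -
  have "emeasure cond_abs_cauchy {..x} =
      emeasure std_cauchy ({- 1..1} \<inter> {y. \<bar>y\<bar> \<le> x}) / emeasure std_cauchy {- 1..1}"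
    by (simp add: emeasure_cond_abs_cauchy)
  also have "\<dots> = ennreal (if x < 0 then 0 else 4 * arctan (min 1 x) / pi)"
  proof (cases "x < 0")
    case False
    have "{- 1..1} \<inter> {y. \<bar>y\<bar> \<le> x} = {- min 1 x..min 1 x}" by auto
    moreover have "emeasure std_cauchy {- min 1 x..min 1 x} / emeasure std_cauchy {- 1..1}
        = ennreal (2 * arctan (min 1 x) / pi) / ennreal (2 * arctan 1 / pi)"
      using False by (subst (1 2) emeasure_std_cauchy) auto
    moreover have "\<dots> = ennreal (4 * arctan (min 1 x) / pi)"
      using False by (subst divide_ennreal) (auto simp: arctan_one)
    ultimately show ?thesis
      using False by simp
  next
    case True
    then have "{- 1..1} \<inter> {y. \<bar>y\<bar> \<le> x} = {}" by auto
    then show ?thesis using True by simp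
  qed
  finally show ?thesis
    by (simp add: measure_def)
qed

text \<open>Both laws have the distribution function \<open>4 * arctan x / pi\<close> on \<open>[0, 1]\<close>.\<close>

lemma distr_abs_skew: "distr uniform_angle borel (\<lambda>\<theta>. \<bar>skew \<theta>\<bar>) = cond_abs_cauchy"
proof (rule cdf_unique)
  interpret U: prob_space uniform_angle by (rule prob_space_uniform_angle)
  show "real_distribution (distr uniform_angle borel (\<lambda>\<theta>. \<bar>skew \<theta>\<bar>))"
    by (rule U.real_distribution_distr) auto
  interpret C: prob_space "uniform_measure std_cauchy {x. \<bar>x\<bar> \<le> 1}" by (rule cond_abs_cauchy_space)
  show "real_distribution cond_abs_cauchy"
    unfolding cond_abs_cauchy_def by (rule C.real_distribution_distr) (simp add: std_cauchy_def)
  show "cdf (distr uniform_angle borel (\<lambda>\<theta>. \<bar>skew \<theta>\<bar>)) = cdf cond_abs_cauchy"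
  proof
    fix x
    have [measurable]: "{\<theta>. \<bar>skew \<theta>\<bar> \<le> x} \<in> sets borel" by measurable
    have "emeasure (distr uniform_angle borel (\<lambda>\<theta>. \<bar>skew \<theta>\<bar>)) {..x}
        = emeasure lborel ({0..<2 * pi} \<inter> {\<theta>. \<bar>skew \<theta>\<bar> \<le> x}) / ennreal (2 * pi)"
      by (subst emeasure_distr) (auto simp: vimage_def)
    also have "\<dots> = ennreal (if x < 0 then 0 else 4 * arctan (min 1 x) / pi)"
    proof -
      consider "x < 0" | "0 \<le> x" "x < 1" | "1 \<le> x" by linarith
      then show ?thesis
      proof cases
        case 1
        then have "{\<theta>. \<bar>skew \<theta>\<bar> \<le> x} = {}" by (auto simp: not_le intro: less_le_trans)
        then show ?thesis using 1 by simp
      next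
        case 2
        then show ?thesis by (simp add: emeasure_abs_skew_le divide_ennreal)
      next
        case 3
        then have "{\<theta>. \<bar>skew \<theta>\<bar> \<le> x} = UNIV" using abs_skew_le_1 by (auto intro: order_trans)
        then show ?thesis using 3 by (simp add: arctan_one divide_ennreal)
      qed
    qed
    finally show "cdf (distr uniform_angle borel (\<lambda>\<theta>. \<bar>skew \<theta>\<bar>)) x = cdf cond_abs_cauchy x"
      unfolding cdf_def cond_abs_cauchy_cdf by (simp add: measure_def)
  qed
qed

lemma AE_abs_skew_less_1: "AE \<theta> in uniform_angle. \<bar>skew \<theta>\<bar> < 1"
proof -
  have "AE x in lborel. x \<notin> {- 1, 1 :: real}"
    by (rule AE_not_in) (auto intro: finite_imp_null_set_lborel)
  then have "emeasure std_cauchy {- 1, 1} = 0"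
    unfolding std_cauchy_def
    by (subst emeasure_density) (auto simp: nn_integral_0_iff_AE split: split_indicator)
  moreover have "{- 1..1} \<inter> {x. \<bar>x\<bar> \<in> {1}} = {- 1, 1 :: real}" by auto
  ultimately have "emeasure cond_abs_cauchy {1} = 0"
    by (simp only: emeasure_cond_abs_cauchy borel_singleton[OF sets.empty_sets]) simp
  then have "{1} \<in> null_sets cond_abs_cauchy"
    by (intro null_setsI) (auto simp: cond_abs_cauchy_space)
  then have "AE x in cond_abs_cauchy. x \<noteq> 1"
    using AE_not_in by fastforce
  then have "AE \<theta> in uniform_angle. \<bar>skew \<theta>\<bar> \<noteq> 1"
    unfolding distr_abs_skew[symmetric] by (subst (asm) AE_distr_iff) auto
  then show ?thesis
    by eventually_elim (use abs_skew_le_1 in \<open>auto simp: less_le\<close>)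
qed

lemma uniform_angles_eq_PiM: "uniform_angles n = (\<Pi>\<^sub>M j\<in>{1..n}. uniform_angle)"
proof -
  interpret U: prob_space uniform_angle by (rule prob_space_uniform_angle)
  interpret product_sigma_finite "\<lambda>_::nat. uniform_angle"
    by (simp add: product_sigma_finite_def U.sigma_finite_measure_axioms)
  interpret L: product_sigma_finite "\<lambda>_::nat. lborel :: real measure"
    by (simp add: product_sigma_finite_def lborel.sigma_finite_measure_axioms)
  show ?thesis
  proof (rule PiM_eqI)
    fix A :: "nat \<Rightarrow> real set" assume "\<And>i. i \<in> {1..n} \<Longrightarrow> A i \<in> sets uniform_angle"
    then have A: "A i \<in> sets lborel" if "i \<in> {1..n}" for i using that by simp
    let ?I = "{0..<2 * pi}"
    have "emeasure (uniform_angles n) (Pi\<^sub>E {1..n} A)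
        = emeasure (\<Pi>\<^sub>M j\<in>{1..n}. lborel) (\<Pi>\<^sub>E i\<in>{1..n}. ?I \<inter> A i)
          / emeasure (\<Pi>\<^sub>M j\<in>{1..n}. lborel) (\<Pi>\<^sub>E i\<in>{1..n}. ?I)"
      unfolding uniform_angles_def using A
      by (subst emeasure_uniform_measure) (auto simp: PiE_Int intro!: sets_PiM_I_finite)
    also have "\<dots> = (\<Prod>i\<in>{1..n}. emeasure lborel (?I \<inter> A i)) / (\<Prod>i\<in>{1..n}. emeasure lborel ?I)"
      using A by (intro arg_cong2[where f = "(/)"] L.emeasure_PiM) auto
    also have "\<dots> = (\<Prod>i\<in>{1..n}. emeasure lborel (?I \<inter> A i) / emeasure lborel ?I)"
      by (simp add: divide_ennreal_def prod.distrib ennreal_inverse_power)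
    finally show "emeasure (uniform_angles n) (Pi\<^sub>E {1..n} A) = (\<Prod>i\<in>{1..n}. emeasure uniform_angle (A i))"
      using A by simp
  qed (auto simp: uniform_angles_def intro!: sets_PiM_cong)
qed

text \<open>The sorting permutation is an arbitrary, possibly non-measurable function of the outcome, and so
is the growth factor outside of the event where it is determined by the angles. Hence it is
a random variable only on the completed space.\<close>

lemma completion_AE_eq:
  assumes g [measurable]: "g \<in> borel_measurable M" and ae: "AE x in M. f x = g x"
  shows "f \<in> borel_measurable (completion M)"
    and "distr (completion M) borel f = distr M borel g"
proof -
  obtain N where N: "{x \<in> space M. f x \<noteq> g x} \<subseteq> N" "N \<in> null_sets M"
    using ae by (auto elim!: AE_E intro: null_setsI)
  show f: "f \<in> borel_measurable (completion M)"
  proof (rule measurableI)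
    fix A :: "'b set" assume [measurable]: "A \<in> sets borel"
    have "f -` A \<inter> space M = (g -` A \<inter> space M - N) \<union> (f -` A \<inter> space M \<inter> N)"
      using N(1) by auto
    moreover have "g -` A \<inter> space M - N \<in> sets (completion M)"
      using N(2) by (intro sets_completionI_sets sets.Diff) auto
    moreover have "f -` A \<inter> space M \<inter> N \<in> null_sets (completion M)"
      by (rule null_sets_completion_subset[OF _ null_sets_completionI[OF N(2)]]) auto
    ultimately show "f -` A \<inter> space (completion M) \<in> sets (completion M)"
      by (metis null_setsD2 sets.Un space_completion)
  qed simp
  have "distr (completion M) borel f = distr (completion M) borel g"
    using f measurable_completion[OF g] AE_completion[OF ae] by (intro distr_cong_AE) auto
  then show "distr (completion M) borel f = distr M borel g"
    by (simp add: distr_completion)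
qed

lemma distr_growth_uniform_angles:
  "distr (uniform_angles n) borel (\<lambda>x. \<Prod>j\<in>{1..n}. 1 + (skew (x j))\<^sup>2)
    = distr (\<Pi>\<^sub>M j\<in>{1..n}. cond_abs_cauchy) borel (\<lambda>x. \<Prod>j\<in>{1..n}. 1 + (x j)\<^sup>2)"
proof -
  let ?I = "{1..n}" and ?X = "\<lambda>\<theta>. \<bar>skew \<theta>\<bar>"
  let ?U = "\<Pi>\<^sub>M j\<in>?I. uniform_angle" and ?C = "\<Pi>\<^sub>M j\<in>?I. cond_abs_cauchy"
  have [measurable_cong]: "sets cond_abs_cauchy = sets borel" by (rule cond_abs_cauchy_space)
  have "compose ?I ?X \<in> ?U \<rightarrow>\<^sub>M ?C"
    unfolding compose_def by measurable
  note [measurable] = this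
  have X [measurable]: "?X \<in> uniform_angle \<rightarrow>\<^sub>M cond_abs_cauchy" by measurable
  have "distr uniform_angle cond_abs_cauchy ?X = cond_abs_cauchy"
    by (subst distr_abs_skew[symmetric]) (auto intro!: distr_cong simp: cond_abs_cauchy_space)
  then have "?C = distr ?U ?C (compose ?I ?X)"
    using distr_PiM_finite_prob_space'[OF finite_atLeastAtMost, of 1 n "\<lambda>_. uniform_angle"
        "\<lambda>_. cond_abs_cauchy" ?X] prob_space_uniform_angle cond_abs_cauchy_space X by simp
  then have "distr ?C borel (\<lambda>x. \<Prod>j\<in>?I. 1 + (x j)\<^sup>2)
      = distr (distr ?U ?C (compose ?I ?X)) borel (\<lambda>x. \<Prod>j\<in>?I. 1 + (x j)\<^sup>2)"
    by simp
  also have "\<dots> = distr ?U borel ((\<lambda>x. \<Prod>j\<in>?I. 1 + (x j)\<^sup>2) \<circ> compose ?I ?X)"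
    by (rule distr_distr) measurable
  also have "(\<lambda>x. \<Prod>j\<in>?I. 1 + (x j)\<^sup>2) \<circ> compose ?I ?X = (\<lambda>x. \<Prod>j\<in>?I. 1 + (skew (x j))\<^sup>2)"
    by (auto simp: fun_eq_iff compose_def intro!: prod.cong)
  finally show ?thesis
    by (simp add: uniform_angles_eq_PiM)
qed

lemma distr_prod_indep:
  assumes "prob_space M'" "I \<noteq> {}"
    and indep: "prob_space.indep_vars M' (\<lambda>j. borel) Y I"
    and law: "\<And>j. j \<in> I \<Longrightarrow> distr M' borel (Y j) = Q"
  shows "distr M' borel (\<lambda>\<omega>. \<Prod>j\<in>I. 1 + (Y j \<omega>)\<^sup>2)
    = distr (\<Pi>\<^sub>M j\<in>I. Q) borel (\<lambda>x. \<Prod>j\<in>I. 1 + (x j :: real)\<^sup>2)"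
proof -
  interpret prob_space M' by fact
  have rv [measurable]: "Y j \<in> borel_measurable M'" if "j \<in> I" for j
    using indep that by (auto simp: indep_vars_def)
  let ?Y = "\<lambda>\<omega>. \<lambda>j\<in>I. Y j \<omega>"
  have "distr M' (\<Pi>\<^sub>M j\<in>I. borel) ?Y = (\<Pi>\<^sub>M j\<in>I. distr M' borel (Y j))"
    using indep_vars_iff_distr_eq_PiM'[where M' = "\<lambda>_. borel" and X = Y, OF \<open>I \<noteq> {}\<close>] rv indep by simp
  also have "\<dots> = (\<Pi>\<^sub>M j\<in>I. Q)"
    using law by (intro PiM_cong) auto
  finally have "distr (\<Pi>\<^sub>M j\<in>I. Q) borel (\<lambda>x. \<Prod>j\<in>I. 1 + (x j)\<^sup>2)
      = distr (distr M' (\<Pi>\<^sub>M j\<in>I. borel) ?Y) borel (\<lambda>x. \<Prod>j\<in>I. 1 + (x j)\<^sup>2)"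
    by simp
  also have "\<dots> = distr M' borel ((\<lambda>x. \<Prod>j\<in>I. 1 + (x j)\<^sup>2) \<circ> ?Y)"
    by (rule distr_distr) measurable
  also have "(\<lambda>x. \<Prod>j\<in>I. 1 + (x j)\<^sup>2) \<circ> ?Y = (\<lambda>\<omega>. \<Prod>j\<in>I. 1 + (Y j \<omega>)\<^sup>2)"
    by (auto simp: fun_eq_iff intro!: prod.cong)
  finally show ?thesis by simp
qed

section \<open>Growth factors as extended reals\<close>

lemma min_abs_tan_cot: "min (abs_tan \<theta>) (abs_cot \<theta>) = ereal \<bar>skew \<theta>\<bar>"
  using sin_zero_norm_cos_one[of \<theta>]
  by (auto simp: abs_skew abs_tan_def abs_cot_def tan_def cot_def min_def)

lemma abs_tan_le_1_iff: "abs_tan \<theta> \<le> 1 \<longleftrightarrow> \<bar>sin \<theta>\<bar> \<le> \<bar>cos \<theta>\<bar>"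
proof (cases "cos \<theta> = 0")
  case True
  then show ?thesis using cos_nonzero_if_dominant by (auto simp: abs_tan_def)
next
  case False
  then have "\<bar>tan \<theta>\<bar> \<le> 1 \<longleftrightarrow> \<bar>sin \<theta>\<bar> \<le> \<bar>cos \<theta>\<bar>" by (simp add: tan_def abs_divide)
  then show ?thesis using False by (simp add: abs_tan_def)
qed

lemma abs_tan_eq_skew: "\<bar>sin \<theta>\<bar> \<le> \<bar>cos \<theta>\<bar> \<Longrightarrow> abs_tan \<theta> = ereal \<bar>skew \<theta>\<bar>"
  using cos_nonzero_if_dominant[of \<theta>] by (simp add: abs_tan_def skew_def tan_def)

lemma min_abs_sec_csc:
  assumes "\<bar>sin \<theta>\<bar> \<le> \<bar>cos \<theta>\<bar>"
  shows "(min (abs_sec \<theta>) (abs_csc \<theta>))\<^sup>2 = ereal (1 + (skew \<theta>)\<^sup>2)"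
proof -
  note c = cos_nonzero_if_dominant[OF assms]
  have "abs_sec \<theta> \<le> abs_csc \<theta>"
    using assms c by (auto simp: abs_sec_def abs_csc_def abs_divide intro!: divide_left_mono)
  then have "min (abs_sec \<theta>) (abs_csc \<theta>) = ereal \<bar>1 / cos \<theta>\<bar>"
    using c by (simp add: min_def abs_sec_def)
  moreover have "\<bar>1 / cos \<theta>\<bar>\<^sup>2 = 1 + (skew \<theta>)\<^sup>2"
    using c assms sin_cos_squared_add[of \<theta>] by (simp add: skew_def power_divide field_simps)
  ultimately show ?thesis by simp
qed

lemma growth_factor_ereal:
  assumes "\<And>j. j \<in> I \<Longrightarrow> \<bar>sin (\<theta> j)\<bar> \<le> \<bar>cos (\<theta> j)\<bar>"
  shows "(\<Prod>j\<in>I. (min (abs_sec (\<theta> j)) (abs_csc (\<theta> j)))\<^sup>2) = ereal (\<Prod>j\<in>I. 1 + (skew (\<theta> j))\<^sup>2)"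
    and "(\<Prod>j\<in>I. 1 + (min (abs_tan (\<theta> j)) (abs_cot (\<theta> j)))\<^sup>2) = ereal (\<Prod>j\<in>I. 1 + (skew (\<theta> j))\<^sup>2)"
proof -
  show "(\<Prod>j\<in>I. (min (abs_sec (\<theta> j)) (abs_csc (\<theta> j)))\<^sup>2) = ereal (\<Prod>j\<in>I. 1 + (skew (\<theta> j))\<^sup>2)"
    unfolding prod_ereal[symmetric] using assms by (intro prod.cong refl min_abs_sec_csc)
  have "1 + (ereal \<bar>x\<bar>)\<^sup>2 = ereal (1 + x\<^sup>2)" for x
    by (metis ereal_power one_ereal_def plus_ereal.simps(1) power2_abs)
  then show "(\<Prod>j\<in>I. 1 + (min (abs_tan (\<theta> j)) (abs_cot (\<theta> j)))\<^sup>2) = ereal (\<Prod>j\<in>I. 1 + (skew (\<theta> j))\<^sup>2)"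
    unfolding min_abs_tan_cot prod_ereal[symmetric] by (simp only:)
qed

text \<open>Almost surely no angle is an odd multiple of \<open>pi / 4\<close>, so there are no ties in the pivot columns.\<close>

lemma AE_uniform_angles_skew: "AE x in uniform_angles n. \<forall>j\<in>{1..n}. \<bar>skew (x j)\<bar> < 1"
  unfolding uniform_angles_eq_PiM
proof (rule AE_finite_allI)
  fix j assume "j \<in> {1..n}"
  then show "AE x in (\<Pi>\<^sub>M j\<in>{1..n}. uniform_angle). \<bar>skew (x j)\<bar> < 1"
    using AE_PiM_component[of "{1..n}" "\<lambda>_. uniform_angle" j "\<lambda>y. \<bar>skew y\<bar> < 1"]
      prob_space_uniform_angle AE_abs_skew_less_1 by blast
qed simp

theorem theorem2:
  fixes n :: nat
    and M :: "'w measure" and \<Theta> :: "'w \<Rightarrow> nat \<Rightarrow> real" and \<sigma> :: "'w \<Rightarrow> nat \<Rightarrow> nat"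
    and M' :: "'v measure" and Y :: "nat \<Rightarrow> 'v \<Rightarrow> real"
  assumes "n \<ge> 1"
  shows
    "(\<forall>\<theta> \<in> {1..n} \<rightarrow> {0..<2 * pi}.
        (\<forall>j\<in>{1..n}. abs_tan (\<theta> j) \<le> 1) \<and>
        (\<forall>j\<in>{1..<n}. abs_tan (\<theta> (j + 1)) \<le> abs_tan (\<theta> j))
        \<longrightarrow>
        factorizations_align {genp, gepp, gerp, gecp} (butterfly n \<theta>) \<and>
        completely_pivoted (butterfly n \<theta>) \<and>
        (\<forall>s \<in> {genp, gepp, gerp, gecp}.
           ereal (growth s (butterfly n \<theta>)) =
             (\<Prod>j\<in>{1..n}. (min (abs_sec (\<theta> j)) (abs_csc (\<theta> j)))\<^sup>2) \<and>
           ereal (growth s (butterfly n \<theta>)) =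
             (\<Prod>j\<in>{1..n}. 1 + (min (abs_tan (\<theta> j)) (abs_cot (\<theta> j)))\<^sup>2)))
     \<and>
     (prob_space M \<and>
      \<Theta> \<in> M \<rightarrow>\<^sub>M (\<Pi>\<^sub>M j\<in>{1..n}. lborel) \<and>
      distr M (\<Pi>\<^sub>M j\<in>{1..n}. lborel) \<Theta> = uniform_angles n \<and>
      (\<forall>\<omega>\<in>space M. \<sigma> \<omega> permutes {1..n} \<and>
         (\<forall>j\<in>{1..<n}.
            min (abs_tan (\<Theta> \<omega> (\<sigma> \<omega> (j + 1)))) (abs_cot (\<Theta> \<omega> (\<sigma> \<omega> (j + 1))))
              \<le> min (abs_tan (\<Theta> \<omega> (\<sigma> \<omega> j))) (abs_cot (\<Theta> \<omega> (\<sigma> \<omega> j)))))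
      \<longrightarrow>
      (AE \<omega> in M. factorizations_align {gepp, gerp, gecp} (butterfly n (\<Theta> \<omega> \<circ> \<sigma> \<omega>))) \<and>
      (\<forall>s \<in> {gepp, gerp, gecp}.
         (\<lambda>\<omega>. growth s (butterfly n (\<Theta> \<omega> \<circ> \<sigma> \<omega>))) \<in> borel_measurable (completion M) \<and>
         (prob_space M' \<and>
          prob_space.indep_vars M' (\<lambda>j. borel) Y {1..n} \<and>
          (\<forall>j\<in>{1..n}. distr M' borel (Y j) = cond_abs_cauchy)
          \<longrightarrow>
          distr (completion M) borel (\<lambda>\<omega>. growth s (butterfly n (\<Theta> \<omega> \<circ> \<sigma> \<omega>))) =
            distr M' borel (\<lambda>\<omega>. \<Prod>j\<in>{1..n}. 1 + (Y j \<omega>)\<^sup>2))))"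
proof (intro conjI ballI impI)
  fix \<theta> :: "nat \<Rightarrow> real"
  assume "\<theta> \<in> {1..n} \<rightarrow> {0..<2 * pi}"
    and "(\<forall>j\<in>{1..n}. abs_tan (\<theta> j) \<le> 1) \<and> (\<forall>j\<in>{1..<n}. abs_tan (\<theta> (j + 1)) \<le> abs_tan (\<theta> j))"
  then have dom: "\<forall>j\<in>{1..n}. \<bar>sin (\<theta> j)\<bar> \<le> \<bar>cos (\<theta> j)\<bar>"
    and "\<forall>j\<in>{1..<n}. abs_tan (\<theta> (j + 1)) \<le> abs_tan (\<theta> j)"
    by (auto simp: abs_tan_le_1_iff)
  then have ord: "\<forall>j\<in>{1..<n}. \<bar>skew (\<theta> (j + 1))\<bar> \<le> \<bar>skew (\<theta> j)\<bar>"
    by (auto simp: abs_tan_eq_skew)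
  note elim = butterfly_elimination[where S = "{genp, gepp, gerp, gecp}", OF ord]
  show "factorizations_align {genp, gepp, gerp, gecp} (butterfly n \<theta>)"
    by (rule elim(1)) (use dom in auto)
  show "completely_pivoted (butterfly n \<theta>)"
    by (rule elim(3)) (use dom in auto)
  fix s assume "s \<in> {genp, gepp, gerp, gecp}"
  then have g: "growth s (butterfly n \<theta>) = (\<Prod>j\<in>{1..n}. 1 + (skew (\<theta> j))\<^sup>2)"
    by (intro elim(2)) (use dom in auto)
  show "ereal (growth s (butterfly n \<theta>)) = (\<Prod>j\<in>{1..n}. (min (abs_sec (\<theta> j)) (abs_csc (\<theta> j)))\<^sup>2)"
    and "ereal (growth s (butterfly n \<theta>)) = (\<Prod>j\<in>{1..n}. 1 + (min (abs_tan (\<theta> j)) (abs_cot (\<theta> j)))\<^sup>2)"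
    unfolding g using growth_factor_ereal[of "{1..n}" \<theta>] dom by auto
next
  let ?S = "{gepp, gerp, gecp}"
  define h where "h x = (\<Prod>j\<in>{1..n}. 1 + (skew (x j))\<^sup>2)" for x :: "nat \<Rightarrow> real"
  assume *: "prob_space M \<and>
      \<Theta> \<in> M \<rightarrow>\<^sub>M (\<Pi>\<^sub>M j\<in>{1..n}. lborel) \<and>
      distr M (\<Pi>\<^sub>M j\<in>{1..n}. lborel) \<Theta> = uniform_angles n \<and>
      (\<forall>\<omega>\<in>space M. \<sigma> \<omega> permutes {1..n} \<and>
         (\<forall>j\<in>{1..<n}.
            min (abs_tan (\<Theta> \<omega> (\<sigma> \<omega> (j + 1)))) (abs_cot (\<Theta> \<omega> (\<sigma> \<omega> (j + 1))))
              \<le> min (abs_tan (\<Theta> \<omega> (\<sigma> \<omega> j))) (abs_cot (\<Theta> \<omega> (\<sigma> \<omega> j)))))"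
  then have \<Theta> [measurable]: "\<Theta> \<in> M \<rightarrow>\<^sub>M (\<Pi>\<^sub>M j\<in>{1..n}. lborel)"
    and law: "distr M (\<Pi>\<^sub>M j\<in>{1..n}. lborel) \<Theta> = uniform_angles n"
    and perm: "\<And>\<omega>. \<omega> \<in> space M \<Longrightarrow> \<sigma> \<omega> permutes {1..n}"
    and ord: "\<And>\<omega>. \<omega> \<in> space M \<Longrightarrow> \<forall>j\<in>{1..<n}.
      \<bar>skew ((\<Theta> \<omega> \<circ> \<sigma> \<omega>) (j + 1))\<bar> \<le> \<bar>skew ((\<Theta> \<omega> \<circ> \<sigma> \<omega>) j)\<bar>"
    by (auto simp: min_abs_tan_cot)
  have [measurable]: "h \<in> borel_measurable (\<Pi>\<^sub>M j\<in>{1..n}. lborel)"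
    unfolding h_def[abs_def] by measurable
  have "AE x in distr M (\<Pi>\<^sub>M j\<in>{1..n}. lborel) \<Theta>. \<forall>j\<in>{1..n}. \<bar>skew (x j)\<bar> < 1"
    unfolding law by (rule AE_uniform_angles_skew)
  then have ae: "AE \<omega> in M. \<forall>j\<in>{1..n}. \<bar>skew (\<Theta> \<omega> j)\<bar> < 1"
    by (rule AE_distrD[OF \<Theta>])
  have elim: "factorizations_align ?S (butterfly n (\<Theta> \<omega> \<circ> \<sigma> \<omega>))"
    "\<And>s. s \<in> ?S \<Longrightarrow> growth s (butterfly n (\<Theta> \<omega> \<circ> \<sigma> \<omega>)) = h (\<Theta> \<omega>)"
    if \<omega>: "\<omega> \<in> space M" and less: "\<forall>j\<in>{1..n}. \<bar>skew (\<Theta> \<omega> j)\<bar> < 1" for \<omega>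
  proof -
    have less': "\<forall>j\<in>{1..n}. \<bar>skew ((\<Theta> \<omega> \<circ> \<sigma> \<omega>) j)\<bar> < 1"
      using less permutes_in_image[OF perm[OF \<omega>]] by simp
    note el = butterfly_elimination[where S = ?S and \<theta> = "\<Theta> \<omega> \<circ> \<sigma> \<omega>", OF ord[OF \<omega>] disjI2[OF less']]
    show "factorizations_align ?S (butterfly n (\<Theta> \<omega> \<circ> \<sigma> \<omega>))"
      by (rule el(1)) auto
    \<comment> \<open>The product does not depend on the order of the angles, so that the permutation drops out.\<close>
    have "(\<Prod>j\<in>{1..n}. 1 + (skew ((\<Theta> \<omega> \<circ> \<sigma> \<omega>) j))\<^sup>2) = h (\<Theta> \<omega>)"
      unfolding h_def using prod.permute[OF perm[OF \<omega>], of "\<lambda>j. 1 + (skew (\<Theta> \<omega> j))\<^sup>2"]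
      by (simp add: comp_def)
    then show "growth s (butterfly n (\<Theta> \<omega> \<circ> \<sigma> \<omega>)) = h (\<Theta> \<omega>)" if "s \<in> ?S" for s
      using el(2)[of s] that by auto
  qed
  show "AE \<omega> in M. factorizations_align ?S (butterfly n (\<Theta> \<omega> \<circ> \<sigma> \<omega>))"
    using ae AE_space by eventually_elim (rule elim(1))
  fix s assume s: "s \<in> ?S"
  let ?g = "\<lambda>\<omega>. growth s (butterfly n (\<Theta> \<omega> \<circ> \<sigma> \<omega>))"
  have h\<Theta>: "(\<lambda>\<omega>. h (\<Theta> \<omega>)) \<in> borel_measurable M" by measurable
  have eq: "AE \<omega> in M. ?g \<omega> = h (\<Theta> \<omega>)"
    using ae AE_space by eventually_elim (rule elim(2)[OF _ _ s])
  show "?g \<in> borel_measurable (completion M)"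
    by (rule completion_AE_eq(1)[OF h\<Theta> eq])
  assume Y: "prob_space M' \<and> prob_space.indep_vars M' (\<lambda>j. borel) Y {1..n} \<and>
    (\<forall>j\<in>{1..n}. distr M' borel (Y j) = cond_abs_cauchy)"
  have "distr (completion M) borel ?g = distr M borel (h \<circ> \<Theta>)"
    using completion_AE_eq(2)[OF h\<Theta> eq] by (simp add: comp_def)
  also have "\<dots> = distr (uniform_angles n) borel h"
    unfolding law[symmetric] by (rule distr_distr[symmetric]) measurable
  also have "\<dots> = distr (\<Pi>\<^sub>M j\<in>{1..n}. cond_abs_cauchy) borel (\<lambda>x. \<Prod>j\<in>{1..n}. 1 + (x j)\<^sup>2)"
    unfolding h_def by (rule distr_growth_uniform_angles)
  also have "\<dots> = distr M' borel (\<lambda>\<omega>. \<Prod>j\<in>{1..n}. 1 + (Y j \<omega>)\<^sup>2)"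
    using Y assms by (intro distr_prod_indep[symmetric]) auto
  finally show "distr (completion M) borel ?g = distr M' borel (\<lambda>\<omega>. \<Prod>j\<in>{1..n}. 1 + (Y j \<omega>)\<^sup>2)" .
qed

end
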